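(* Let $\phi=(\phi_1,\dots,\phi_n):\mathbb{R}^n\to\mathbb{R}^n$ be a global $C^\infty$-diffeomorphism with $|J_\phi(x)|=|\det D\phi(x)|\neq 0$ for all $x$, and let $\omega\in C^\infty(\mathbb{R}^n;\mathbb{C})$ be nowhere vanishing. For every $f\in\mathcal{S}_{\phi,\omega}(\mathbb{R}^n)$ with $\|f\|_{\phi,\omega}=1$, $$\left(\sum_{j=1}^n\Delta_{\phi,\omega}\phi_j\right)\left(\sum_{j=1}^n\Delta_{\phi,\omega}\xi_j\right)\ge\frac{n^2}{4}.$$
   Context: $\mathcal{S}_{\phi,\omega}(\mathbb{R}^n)=\{f:\mathbb{R}^n\to\mathbb{C}\mid (\omega f)\circ\phi^{-1}\in\mathcal{S}(\mathbb{R}^n)\}$, with $\mathcal{S}(\mathbb{R}^n)$ the classical Schwartz space. Inner product and norm: $\langle f,g\rangle_{\phi,\omega}=\int_{\mathbb{R}^n}f\bar g\,|\omega|^2|J_\phi|\,dx$, $\|f\|_{\phi,\omega}^2=\langle f,f\rangle_{\phi,\omega}$. Weighted Fourier transform: $$[\mathcal{F}_{\phi,\omega}f](\xi)=\frac{1}{(2\pi)^{n/2}}\int_{\mathbb{R}^n}e^{-i\xi\cdot\phi(x)}\,\omega(x)f(x)\,|J_\phi(x)|\,dx .$$ Weighted gradient: $\nabla_{\phi,\omega}f(x)=\frac{1}{\omega(x)}[D\phi(x)]^{-T}\nabla(\omega f)(x)$, with $j$-th component $(\nabla_{\phi,\omega})_jf$. Generalized position and momentum operators: $T_jf(x)=\phi_j(x)f(x)$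 and $P_jf=-i(\nabla_{\phi,\omega})_jf$. For $f$ with $\|f\|_{\phi,\omega}=1$, set $\bar\phi_j=\langle T_jf,f\rangle_{\phi,\omega}$, $\bar\xi_j=\langle P_jf,f\rangle_{\phi,\omega}$, and let $\Delta_{\phi,\omega}\phi_j,\Delta_{\phi,\omega}\xi_j\ge 0$ be given by $$(\Delta_{\phi,\omega}\phi_j)^2=\int_{\mathbb{R}^n}(\phi_j(x)-\bar\phi_j)^2|f(x)|^2|\omega(x)|^2|J_\phi(x)|\,dx,\qquad (\Delta_{\phi,\omega}\xi_j)^2=\int_{\mathbb{R}^n}(\xi_j-\bar\xi_j)^2|[\mathcal{F}_{\phi,\omega}f](\xi)|^2\,d\xi .$$ *)

theory Defs
  imports "HOL-Analysis.Analysis"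
begin

section \<open>Smooth maps and the classical Schwartz space\<close>

definition partial_deriv :: "'n::finite \<Rightarrow> (real^'n \<Rightarrow> 'b::real_normed_vector) \<Rightarrow> real^'n \<Rightarrow> 'b" where
  "partial_deriv i g x = frechet_derivative g (at x) (axis i 1)"

text \<open>A multi-index of order \<open>k\<close> is given as a list of \<open>k\<close> coordinate directions, with repetitions.\<close>

definition iterated_partial :: "'n::finite list \<Rightarrow> (real^'n \<Rightarrow> 'b::real_normed_vector) \<Rightarrow> real^'n \<Rightarrow> 'b" where
  "iterated_partial is g = foldr partial_deriv is g"

text \<open>\<open>C\<^sup>\<infinity>\<close>: partial derivatives of all orders exist and are continuous. Each iterated partial
  derivative is required to be totally differentiable, so it is continuous and its own partial
  derivatives exist.\<close>

definition smooth :: "(real^'n::finite \<Rightarrow> 'b::real_normed_vector) \<Rightarrow> bool" where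
  "smooth g \<longleftrightarrow> (\<forall>is x. iterated_partial is g differentiable (at x))"

definition diffeomorphism :: "(real^'n::finite \<Rightarrow> real^'n) \<Rightarrow> bool" where
  "diffeomorphism \<phi> \<longleftrightarrow> bij \<phi> \<and> smooth \<phi> \<and> smooth (inv \<phi>)"

definition schwartz :: "(real^'n::finite \<Rightarrow> complex) set" where
  "schwartz = {g. smooth g \<and>
     (\<forall>(\<alpha> :: 'n \<Rightarrow> nat) is. \<exists>C. \<forall>x. norm ((\<Prod>i\<in>UNIV. (x $ i) ^ \<alpha> i) *\<^sub>R iterated_partial is g x) \<le> C)}"


section \<open>Weighted spaces and operators\<close>

definition weighted_schwartz ::
    "(real^'n::finite \<Rightarrow> real^'n) \<Rightarrow> (real^'n \<Rightarrow> complex) \<Rightarrow> (real^'n \<Rightarrow> complex) set" where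
  "weighted_schwartz \<phi> \<omega> = {f. (\<lambda>x. \<omega> x * f x) \<circ> inv \<phi> \<in> schwartz}"

definition jacobian_det :: "(real^'n::finite \<Rightarrow> real^'n) \<Rightarrow> real^'n \<Rightarrow> real" where
  "jacobian_det \<phi> x = det (jacobian \<phi> (at x))"

definition weighted_inner ::
    "(real^'n::finite \<Rightarrow> real^'n) \<Rightarrow> (real^'n \<Rightarrow> complex) \<Rightarrow>
     (real^'n \<Rightarrow> complex) \<Rightarrow> (real^'n \<Rightarrow> complex) \<Rightarrow> complex" where
  "weighted_inner \<phi> \<omega> f g =
     (LINT x|lborel. f x * cnj (g x) * complex_of_real ((cmod (\<omega> x))\<^sup>2 * \<bar>jacobian_det \<phi> x\<bar>))"

definition weighted_norm ::
    "(real^'n::finite \<Rightarrow> real^'n) \<Rightarrow> (real^'n \<Rightarrow> complex) \<Rightarrow> (real^'n \<Rightarrow> complex) \<Rightarrow> real" where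
  "weighted_norm \<phi> \<omega> f = sqrt (Re (weighted_inner \<phi> \<omega> f f))"

definition weighted_fourier ::
    "(real^'n::finite \<Rightarrow> real^'n) \<Rightarrow> (real^'n \<Rightarrow> complex) \<Rightarrow>
     (real^'n \<Rightarrow> complex) \<Rightarrow> real^'n \<Rightarrow> complex" where
  "weighted_fourier \<phi> \<omega> f \<xi> =
     complex_of_real (1 / (2 * pi) powr (real CARD('n) / 2)) *
     (LINT x|lborel. exp (- \<i> * complex_of_real (\<xi> \<bullet> \<phi> x)) * \<omega> x * f x
        * complex_of_real \<bar>jacobian_det \<phi> x\<bar>)"

definition grad :: "(real^'n::finite \<Rightarrow> complex) \<Rightarrow> real^'n \<Rightarrow> complex^'n" where
  "grad g x = (\<chi> i. partial_deriv i g x)"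

definition weighted_grad ::
    "(real^'n::finite \<Rightarrow> real^'n) \<Rightarrow> (real^'n \<Rightarrow> complex) \<Rightarrow>
     (real^'n \<Rightarrow> complex) \<Rightarrow> real^'n \<Rightarrow> complex^'n" where
  "weighted_grad \<phi> \<omega> f x = (1 / \<omega> x) *s
     (map_matrix complex_of_real (transpose (matrix_inv (jacobian \<phi> (at x))))
        *v grad (\<lambda>y. \<omega> y * f y) x)"

definition position_op ::
    "(real^'n::finite \<Rightarrow> real^'n) \<Rightarrow> 'n \<Rightarrow> (real^'n \<Rightarrow> complex) \<Rightarrow> real^'n \<Rightarrow> complex" where
  "position_op \<phi> j f x = complex_of_real (\<phi> x $ j) * f x"

definition momentum_op ::
    "(real^'n::finite \<Rightarrow> real^'n) \<Rightarrow> (real^'n \<Rightarrow> complex) \<Rightarrow> 'n \<Rightarrow>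
     (real^'n \<Rightarrow> complex) \<Rightarrow> real^'n \<Rightarrow> complex" where
  "momentum_op \<phi> \<omega> j f x = - \<i> * (weighted_grad \<phi> \<omega> f x $ j)"


section \<open>Means and dispersions\<close>

definition mean_position ::
    "(real^'n::finite \<Rightarrow> real^'n) \<Rightarrow> (real^'n \<Rightarrow> complex) \<Rightarrow> (real^'n \<Rightarrow> complex) \<Rightarrow> 'n \<Rightarrow> complex" where
  "mean_position \<phi> \<omega> f j = weighted_inner \<phi> \<omega> (position_op \<phi> j f) f"

definition mean_momentum ::
    "(real^'n::finite \<Rightarrow> real^'n) \<Rightarrow> (real^'n \<Rightarrow> complex) \<Rightarrow> (real^'n \<Rightarrow> complex) \<Rightarrow> 'n \<Rightarrow> complex" where
  "mean_momentum \<phi> \<omega> f j = weighted_inner \<phi> \<omega> (momentum_op \<phi> \<omega> j f) f"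

text \<open>The two means are real numbers, the position and momentum operators being symmetric;
  below, \<open>Re\<close> only moves them from type \<^typ>\<open>complex\<close> to type \<^typ>\<open>real\<close>.\<close>

definition dispersion_position ::
    "(real^'n::finite \<Rightarrow> real^'n) \<Rightarrow> (real^'n \<Rightarrow> complex) \<Rightarrow> (real^'n \<Rightarrow> complex) \<Rightarrow> 'n \<Rightarrow> real" where
  "dispersion_position \<phi> \<omega> f j =
     sqrt (LINT x|lborel. (\<phi> x $ j - Re (mean_position \<phi> \<omega> f j))\<^sup>2
       * (cmod (f x))\<^sup>2 * (cmod (\<omega> x))\<^sup>2 * \<bar>jacobian_det \<phi> x\<bar>)"

definition dispersion_momentum ::
    "(real^'n::finite \<Rightarrow> real^'n) \<Rightarrow> (real^'n \<Rightarrow> complex) \<Rightarrow> (real^'n \<Rightarrow> complex) \<Rightarrow> 'n \<Rightarrow> real" where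
  "dispersion_momentum \<phi> \<omega> f j =
     sqrt (LINT \<xi>|lborel. (\<xi> $ j - Re (mean_momentum \<phi> \<omega> f j))\<^sup>2
       * (cmod (weighted_fourier \<phi> \<omega> f \<xi>))\<^sup>2)"

end

theory Submission
  imports Defs "HOL-Probability.Probability"
begin

text \<open>The substitution \<open>y = \<phi> x\<close> turns \<open>f\<close> into the Schwartz function \<open>g = (\<omega> f) \<circ> \<phi>\<^sup>-\<^sup>1\<close>, the weighted
  integrals into integrals of \<open>g\<close> and the weighted Fourier transform into the usual one. For each
  coordinate, integrating \<open>\<partial>\<^sub>j ((y\<^sub>j - a) |g|\<^sup>2)\<close> gives
  \<open>1 = -2 Re \<integral> (y\<^sub>j - a) cnj g (\<partial>\<^sub>j g - \<i> m g)\<close> for all real \<open>a\<close> and \<open>m\<close>, and Cauchy-Schwarz together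
  with the Plancherel formula yields a product of dispersions of at least \<open>1/2\<close>. The sums over the
  coordinates are combined by Cauchy-Schwarz. The Plancherel formula itself comes from
  damping \<open>|fourier h|\<^sup>2\<close> by a Gaussian that widens monotonically to 1.\<close>

subsection \<open>Change of variables over an arbitrary finite index type\<close>

text \<open>The weight \<open>|\<omega>|\<^sup>2 |J|\<close> is exactly what makes the passage from
  f to g isometric, which is why the bound depends on neither \<phi> nor \<omega>. The momentum
  dispersion is defined on the frequency side, whereas the derivative identity lives on the space
  side. The bridge is Plancherel for h = d_j g - i m g, whose transform is i (xi_j - m) times that
  of g. Plancherel is proved for integrable, continuous, bounded functions, which avoids Fourier
  inversion and any study of the decay of transforms. Undamped, the iterated integral behind
  |fourier h|^2 is not absolutely convergent, so Fubini cannot be applied to it directly; the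
  Gaussian factor repairs this. Integration by parts never meets a boundary term: it always takes
  the form that a partial derivative has integral zero, with one product weight dominating
  everything in sight.\<close>

text \<open>The change of variables theorem of the library needs a wellordered index type. A wellordered
  copy of the index type and a permutation of coordinates remove this restriction.\<close>

datatype 'a wo = Wo (unWo: 'a)

lemma bij_unWo: "bij unWo"
  by (rule bijI') (metis wo.expand wo.exhaust_sel wo.sel)+

instance wo :: (finite) finite
proof
  have "(UNIV :: 'a wo set) = range Wo"
    by (metis surjI wo.collapse)
  then show "finite (UNIV :: 'a wo set)"
    by (metis finite finite_imageI)
qed

text \<open>Since \<open>to_nat\<close> is injective, pulling back the order of the naturals gives a
  wellorder. Finite types are countable, so the copy of a finite index type is both finite and
  wellordered.\<close>

instantiation wo :: (countable) wellorder
begin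

definition less_eq_wo :: "'a wo \<Rightarrow> 'a wo \<Rightarrow> bool" where
  "x \<le> y \<longleftrightarrow> to_nat (unWo x) \<le> to_nat (unWo y)"

definition less_wo :: "'a wo \<Rightarrow> 'a wo \<Rightarrow> bool" where
  "x < y \<longleftrightarrow> to_nat (unWo x) < to_nat (unWo y)"

instance
proof
  fix P :: "'a wo \<Rightarrow> bool" and a :: "'a wo"
  assume step: "\<And>x. (\<And>y. y < x \<Longrightarrow> P y) \<Longrightarrow> P x"
  show "P a"
    by (induction "to_nat (unWo a)" arbitrary: a rule: less_induct) (metis step less_wo_def)
qed (auto simp: less_eq_wo_def less_wo_def intro: wo.expand)

end

section \<open>Relabelling coordinates: Lebesgue measure, determinants, change of variables\<close>

definition reindex :: "('m \<Rightarrow> 'n) \<Rightarrow> real^'n::finite \<Rightarrow> real^'m::finite" where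
  "reindex r x = (\<chi> i. x $ r i)"

lemma reindex_nth [simp]: "reindex r x $ i = x $ r i"
  by (simp add: reindex_def)

lemma linear_reindex: "linear (reindex r)"
  by (rule linearI) (simp_all add: vec_eq_iff)

lemma reindex_inv:
  assumes "bij r"
  shows "reindex r (reindex (inv r) x) = x" "reindex (inv r) (reindex r y) = y"
  using assms by (simp_all add: vec_eq_iff bij_is_inj bij_is_surj surj_f_inv_f)

lemma borel_measurable_reindex [measurable]: "reindex r \<in> borel_measurable borel"
  by (intro borel_measurable_continuous_onI linear_continuous_on linear_linear[THEN iffD2] linear_reindex)

lemma prod_Basis_axis:
  "(\<Prod>b\<in>(Basis :: (real^'n::finite) set). f b) = (\<Prod>i\<in>UNIV. f (axis i 1))"
proof -
  have "inj (\<lambda>i. axis i 1 :: real^'n)"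
    by (simp add: inj_on_def axis_eq_axis)
  moreover have "Basis = range (\<lambda>i. axis i 1 :: real^'n)"
    by (auto simp: Basis_vec_def)
  ultimately show ?thesis
    using prod.reindex[of "\<lambda>i. axis i 1 :: real^'n" UNIV f] by (simp add: o_def)
qed

lemma prod_Basis_cart: "(\<Prod>b\<in>Basis. (u :: real^'n::finite) \<bullet> b) = (\<Prod>i\<in>UNIV. u $ i)"
  by (simp add: prod_Basis_axis inner_axis)

text \<open>Relabelling coordinates carries boxes to boxes with the same side lengths in another
  order, and \<open>lborel\<close> is determined by the volumes of boxes.\<close>

lemma distr_reindex:
  fixes r :: "'m::finite \<Rightarrow> 'n::finite"
  assumes r: "bij r"
  shows "distr lborel borel (reindex r) = lborel"
proof (rule lborel_eqI[symmetric])
  fix l u :: "real^'m"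
  assume le: "\<And>b. b \<in> Basis \<Longrightarrow> l \<bullet> b \<le> u \<bullet> b"
  have le': "l $ i \<le> u $ i" for i
    using le[of "axis i 1"] by (simp add: inner_axis)
  \<comment> \<open>The substitution j = r i inside a universal quantifier; it matches the two box
    conditions coordinate by coordinate.\<close>
  have all: "(\<forall>i. P i (r i)) \<longleftrightarrow> (\<forall>j. P (inv r j) j)" for P
    using r by (metis bij_inv_eq_iff)
  have "reindex r -` box l u = box (reindex (inv r) l) (reindex (inv r) u)"
    unfolding set_eq_iff vimage_eq mem_box_cart reindex_nth
    by (intro allI all[of "\<lambda>i j. l $ i < _ $ j \<and> _ $ j < u $ i"])
  then have "emeasure (distr lborel borel (reindex r)) (box l u)
      = emeasure lborel (box (reindex (inv r) l) (reindex (inv r) u))"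
    by (simp add: emeasure_distr)
  also have "\<dots> = ennreal (\<Prod>b\<in>Basis. (reindex (inv r) u - reindex (inv r) l) \<bullet> b)"
    using le' by (intro emeasure_lborel_box) (auto simp: Basis_vec_def inner_axis)
  also have "\<dots> = ennreal (\<Prod>j\<in>UNIV. (u - l) $ inv r j)"
    by (simp add: prod_Basis_cart)
  also have "(\<Prod>j\<in>UNIV. (u - l) $ inv r j) = (\<Prod>i\<in>UNIV. (u - l) $ i)"
    using prod.reindex_bij_betw[OF bij_imp_bij_inv[OF r], of "\<lambda>i. (u - l) $ i"] by simp
  finally show "emeasure (distr lborel borel (reindex r)) (box l u) = (\<Prod>b\<in>Basis. (u - l) \<bullet> b)"
    by (simp only: prod_Basis_cart)
qed simp

text \<open>In the Leibniz formula, conjugation by r is a sign-preserving bijection between the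
  permutations of the two index types, and it matches the products factor by factor.\<close>

lemma det_reindex:
  fixes r :: "'m::finite \<Rightarrow> 'n::finite" and A :: "real^'n^'n"
  assumes r: "bij r"
  shows "det (\<chi> i j. A $ r i $ r j) = det A"
proof -
  have inj: "inj r"
    using r by (rule bij_is_inj)
  have bij: "bij_betw (map_permutation UNIV r) {p. p permutes UNIV} {q. q permutes UNIV}"
  proof (rule bij_betwI[where g="map_permutation UNIV (inv r)"])
    show "map_permutation UNIV r \<in> {p. p permutes UNIV} \<rightarrow> {q. q permutes UNIV}"
      using r by (auto intro: map_permutation_permutes)
    show "map_permutation UNIV (inv r) \<in> {p. p permutes UNIV} \<rightarrow> {q. q permutes UNIV}"
      using bij_imp_bij_inv[OF r] by (auto intro: map_permutation_permutes)
    show "map_permutation UNIV (inv r) (map_permutation UNIV r p) = p" if "p \<in> {p. p permutes UNIV}" for p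
      using that r by (intro map_permutation_compose_inv[where A=UNIV]) (auto simp: bij_is_inj)
    show "map_permutation UNIV r (map_permutation UNIV (inv r) p) = p" if "p \<in> {p. p permutes UNIV}" for p
      using that r bij_imp_bij_inv[OF r]
      by (intro map_permutation_compose_inv[where A=UNIV]) (auto simp: bij_is_surj surj_f_inv_f)
  qed
  have "det A = (\<Sum>p | p permutes UNIV. of_int (sign (map_permutation UNIV r p)) *
      (\<Prod>i\<in>UNIV. A $ i $ map_permutation UNIV r p i))"
    unfolding det_def by (rule sum.reindex_bij_betw[OF bij, symmetric])
  also have "\<dots> = (\<Sum>p | p permutes UNIV. of_int (sign p) * (\<Prod>i\<in>UNIV. A $ r i $ r (p i)))"
  proof (intro sum.cong refl arg_cong2[where f="(*)"])
    fix p :: "'m \<Rightarrow> 'm" assume "p \<in> {p. p permutes UNIV}"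
    then show "of_int (sign (map_permutation UNIV r p)) = (of_int (sign p) :: real)"
      using inj by (simp add: sign_map_permutation)
    show "(\<Prod>i\<in>UNIV. A $ i $ map_permutation UNIV r p i) = (\<Prod>i\<in>UNIV. A $ r i $ r (p i))"
      using prod.reindex_bij_betw[OF r, of "\<lambda>i. A $ i $ map_permutation UNIV r p i"] inj
      by (simp add: map_permutation_apply)
  qed
  finally show ?thesis
    by (simp add: det_def)
qed

lemma matrix_reindex_conjugate:
  assumes "linear D" "bij r"
  shows "matrix (\<lambda>x. reindex r (D (reindex (inv r) x))) = (\<chi> i j. matrix D $ r i $ r j)"
proof -
  have *: "reindex (inv r) (axis j 1) = axis (r j) 1" for j
    using assms(2) by (auto simp: vec_eq_iff axis_def bij_is_inj inv_f_f bij_is_surj surj_f_inv_f)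
  show ?thesis
    by (simp add: matrix_def *)
qed

text \<open>Conjugating \<phi> by the relabelling gives a map \<psi> over a wellordered index type
  with the same Jacobian determinant at corresponding points. The relabelling preserves Lebesgue
  measure, so the formula for \<psi> carries back to \<phi>.\<close>

lemma integral_change_of_variables_bij:
  fixes \<phi> :: "real^'n::finite \<Rightarrow> real^'n" and h :: "real^'n \<Rightarrow> real"
  assumes \<phi>: "bij \<phi>" "\<And>x. \<phi> differentiable (at x)"
    and J [measurable]: "jacobian_det \<phi> \<in> borel_measurable borel"
    and h: "integrable lborel h"
  shows "integrable lborel (\<lambda>x. \<bar>jacobian_det \<phi> x\<bar> * h (\<phi> x))" (is ?int)
    and "(LINT x|lborel. \<bar>jacobian_det \<phi> x\<bar> * h (\<phi> x)) = (LINT y|lborel. h y)" (is ?eq)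
proof -
  let ?R = "reindex (unWo :: 'n wo \<Rightarrow> 'n)" and ?Q = "reindex (inv (unWo :: 'n wo \<Rightarrow> 'n))"
  define D where "D x = frechet_derivative \<phi> (at x)" for x
  have D: "(\<phi> has_derivative D x) (at x)" for x
    using \<phi>(2) unfolding D_def by (simp add: frechet_derivative_works)
  have J_eq: "jacobian_det \<phi> x = det (matrix (D x))" for x
    by (simp add: jacobian_det_def jacobian_def D_def)
  have [measurable]: "h \<in> borel_measurable borel"
    using borel_measurable_integrable[OF h] by simp
  have [measurable]: "\<phi> \<in> borel_measurable borel"
    by (intro borel_measurable_continuous_onI continuous_at_imp_continuous_on ballI differentiable_imp_continuous_within \<phi>)
  have distr_Q: "distr lborel borel ?Q = lborel"
    by (intro distr_reindex bij_imp_bij_inv bij_unWo)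
  have Q_int: "integrable lborel (\<lambda>y. k (?Q y)) \<longleftrightarrow> integrable lborel k"
    if [measurable]: "k \<in> borel_measurable borel" for k :: "real^'n \<Rightarrow> real"
    using integrable_distr_eq[of ?Q lborel borel k] by (simp add: distr_Q)
  have Q_eq: "(LINT y|lborel. k (?Q y)) = (LINT x|lborel. k x)"
    if [measurable]: "k \<in> borel_measurable borel" for k :: "real^'n \<Rightarrow> real"
    using integral_distr[of ?Q lborel borel k] by (simp add: distr_Q)
  define \<psi> where "\<psi> y = ?R (\<phi> (?Q y))" for y
  define \<psi>' where "\<psi>' y = (\<lambda>v. ?R (D (?Q y) (?Q v)))" for y
  have bl: "bounded_linear ?R" "bounded_linear ?Q"
    by (simp_all add: linear_linear linear_reindex)
  have der: "(\<psi> has_derivative \<psi>' y) (at y within UNIV)" for y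
    unfolding \<psi>_def \<psi>'_def
    by (auto intro!: bounded_linear.has_derivative[OF bl(1)]
        has_derivative_compose[of ?Q ?Q _ _ \<phi>] D bounded_linear_imp_has_derivative bl)
  have "bij \<psi>"
  proof (rule bijI)
    show "inj \<psi>"
      unfolding \<psi>_def using \<phi>(1)
      by (intro injI) (metis bij_def inv_f_eq reindex_inv bij_unWo)
    show "surj \<psi>"
      unfolding \<psi>_def using \<phi>(1)
      by (metis (no_types, lifting) bij_is_surj surj_def reindex_inv bij_unWo)
  qed
  have det_\<psi>': "det (matrix (\<psi>' y)) = jacobian_det \<phi> (?Q y)" for y
    unfolding \<psi>'_def J_eq
    by (simp add: matrix_reindex_conjugate det_reindex bij_unWo has_derivative_linear[OF D])
  have Q\<psi>: "?Q (\<psi> y) = \<phi> (?Q y)" for y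
    by (simp add: \<psi>_def reindex_inv bij_unWo)
  have hQ: "integrable lborel (\<lambda>y. h (?Q y))"
    using h by (simp add: Q_int)
  \<comment> \<open>The theorem applied here concerns vector-valued integrands, so real values are
    wrapped as vectors of length one.\<close>
  have cov: "(\<lambda>y. \<bar>det (matrix (\<psi>' y))\<bar> *\<^sub>R vec (h (?Q (\<psi> y))) :: real^1) absolutely_integrable_on UNIV \<and>
     integral UNIV (\<lambda>y. \<bar>det (matrix (\<psi>' y))\<bar> *\<^sub>R vec (h (?Q (\<psi> y))) :: real^1) = vec b
     \<longleftrightarrow> (\<lambda>y. vec (h (?Q y)) :: real^1) absolutely_integrable_on (\<psi> ` UNIV) \<and>
       integral (\<psi> ` UNIV) (\<lambda>y. vec (h (?Q y)) :: real^1) = vec b" for b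
    using \<open>bij \<psi>\<close> by (intro has_absolute_integral_change_of_variables der) (auto simp: bij_is_inj)
  have "(\<lambda>y. h (?Q y)) absolutely_integrable_on UNIV"
    using hQ unfolding set_integrable_def by (simp add: integrable_completion)
  moreover have "integral UNIV (\<lambda>y. h (?Q y)) = (LINT y|lborel. h (?Q y))"
    using hQ by (simp add: integral_lborel)
  ultimately have *: "(\<lambda>y. \<bar>det (matrix (\<psi>' y))\<bar> * h (?Q (\<psi> y))) absolutely_integrable_on UNIV"
      "integral UNIV (\<lambda>y. \<bar>det (matrix (\<psi>' y))\<bar> * h (?Q (\<psi> y))) = (LINT y|lborel. h (?Q y))"
    using cov[of "LINT y|lborel. h (?Q y)"] bij_is_surj[OF \<open>bij \<psi>\<close>]
    by (simp_all add: absolutely_integrable_on_1_iff integral_on_1_eq)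
  define k where "k x = \<bar>jacobian_det \<phi> x\<bar> * h (\<phi> x)" for x
  have [measurable]: "k \<in> borel_measurable borel"
    unfolding k_def by measurable
  \<comment> \<open>Absolute integrability refers to the completed measure; Borel measurability of
    \<open>k\<close> brings the statement back to \<open>lborel\<close>.\<close>
  have kQ: "integrable lborel (\<lambda>y. k (?Q y))"
    using *(1) unfolding set_integrable_def
    by (simp add: integrable_completion det_\<psi>' Q\<psi> k_def)
  then show ?int
    by (simp add: Q_int k_def[symmetric])
  have "(LINT y|lborel. k (?Q y)) = (LINT y|lborel. h (?Q y))"
    using *(2) kQ by (simp add: det_\<psi>' Q\<psi> k_def integral_lborel)
  then show ?eq
    by (simp add: Q_eq k_def[symmetric])
qed

subsection \<open>Gaussian integrals\<close>

text \<open>\<open>lborel\<close> is the image of a product measure indexed by the basis, so Fubini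
  splits the integral. Both the Gaussian and the decay weight are products over coordinates and
  reduce to dimension one this way.\<close>

lemma has_bochner_integral_lborel_prod:
  fixes k :: "'n::finite \<Rightarrow> real \<Rightarrow> 'a::{real_normed_field,banach,second_countable_topology}"
  assumes k: "\<And>i. has_bochner_integral lborel (k i) (c i)"
  shows "has_bochner_integral lborel (\<lambda>x :: real^'n. \<Prod>i\<in>UNIV. k i (x $ i)) (\<Prod>i\<in>UNIV. c i)"
proof -
  interpret product_sigma_finite "\<lambda>b :: real^'n. lborel :: real measure" ..
  let ?k = "\<lambda>b :: real^'n. k (axis_index b)"
  let ?T = "\<lambda>g :: real^'n \<Rightarrow> real. \<Sum>b\<in>Basis. g b *\<^sub>R b"
  have int: "integrable lborel (?k b)" for b
    using k by (simp add: has_bochner_integral_iff)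
  have [measurable]: "k i \<in> borel_measurable borel" for i
    using k[of i] by (auto simp: has_bochner_integral_iff dest: borel_measurable_integrable)
  have T_nth: "?T g $ i = g (axis i 1)" for g i
    using inner_sum_left_Basis[of "axis i 1 :: real^'n" g] by (simp add: cart_eq_inner_axis)
  have eq: "(\<Prod>i\<in>UNIV. k i (?T g $ i)) = (\<Prod>b\<in>Basis. ?k b (g b))" for g
    by (simp only: T_nth prod_Basis_axis axis_index_axis)
  have "has_bochner_integral (\<Pi>\<^sub>M b\<in>Basis. lborel) (\<lambda>g. \<Prod>i\<in>UNIV. k i (?T g $ i)) (\<Prod>b\<in>Basis. LINT x|lborel. ?k b x)"
    unfolding eq has_bochner_integral_iff
    using int by (auto intro!: product_integrable_prod product_integral_prod)
  also have "(\<Prod>b\<in>Basis. LINT x|lborel. ?k b x) = (\<Prod>i\<in>UNIV. c i)"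
    using k by (simp add: prod_Basis_axis has_bochner_integral_iff)
  finally show ?thesis
    by (subst lborel_eq) (simp add: has_bochner_integral_distr)
qed

definition gauss :: "real^'n::finite \<Rightarrow> real" where
  "gauss z = (\<Prod>i\<in>UNIV. std_normal_density (z $ i))"

lemma gauss_nonneg: "0 \<le> gauss z"
  unfolding gauss_def by (intro prod_nonneg) simp

lemma borel_measurable_gauss [measurable]: "gauss \<in> borel_measurable borel"
  unfolding gauss_def by measurable

lemma gauss_eq:
  fixes z :: "real^'n::finite"
  shows "gauss z = exp (- (norm z)\<^sup>2 / 2) / (2 * pi) powr (real CARD('n) / 2)"
proof -
  have "(\<Sum>i\<in>UNIV. - (z $ i)\<^sup>2 / 2) = - (norm z)\<^sup>2 / 2"
    by (simp add: norm_vec_def L2_set_def sum_nonneg sum_negf sum_divide_distrib)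
  moreover have "sqrt (2 * pi) ^ CARD('n) = (2 * pi) powr (real CARD('n) / 2)"
    by (simp add: powr_half_sqrt[symmetric] powr_realpow[symmetric] powr_powr)
  ultimately show ?thesis
    by (simp add: gauss_def std_normal_density_def prod_dividef exp_sum[symmetric])
qed

text \<open>This is the characteristic function of the standard normal law, written as a Lebesgue
  integral against its density.\<close>

lemma has_bochner_integral_std_normal_cis:
  "has_bochner_integral lborel (\<lambda>x. cis (t * x) * std_normal_density x) (exp (- t\<^sup>2 / 2))"
proof -
  interpret real_distribution std_normal_distribution
    by (rule real_dist_normal_dist)
  have eq: "cis (t * x) * complex_of_real (std_normal_density x) = std_normal_density x *\<^sub>R iexp (t * x)" for x
    by (simp add: scaleR_conv_of_real cis_conv_exp)
  have "integrable std_normal_distribution (\<lambda>x. iexp (t * x))"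
    by (intro integrable_iexp) auto
  then have "integrable lborel (\<lambda>x. cis (t * x) * std_normal_density x)"
    by (simp add: integrable_density eq)
  moreover have "(LINT x|lborel. cis (t * x) * std_normal_density x) = exp (- t\<^sup>2 / 2)"
    using char_std_normal_distribution[THEN fun_cong, of t] by (simp add: char_def integral_density eq)
  ultimately show ?thesis
    by (simp add: has_bochner_integral_iff)
qed

lemma has_bochner_integral_gauss_cis:
  fixes t :: "real^'n::finite"
  shows "has_bochner_integral lborel (\<lambda>z. cis (t \<bullet> z) * gauss z) (exp (- (norm t)\<^sup>2 / 2))"
proof -
  have "(\<Sum>i\<in>UNIV. - (t $ i)\<^sup>2 / 2) = - (norm t)\<^sup>2 / 2"
    by (simp add: norm_vec_def L2_set_def sum_nonneg sum_negf sum_divide_distrib)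
  then have "(\<Prod>i\<in>UNIV. complex_of_real (exp (- (t $ i)\<^sup>2 / 2))) = exp (- (norm t)\<^sup>2 / 2)"
    by (simp add: exp_sum[symmetric] flip: of_real_prod)
  moreover have "(\<Prod>i\<in>UNIV. cis (t $ i * z $ i) * std_normal_density (z $ i)) = cis (t \<bullet> z) * gauss z" for z
    by (simp add: prod.distrib gauss_def inner_vec_def cis_conv_exp exp_sum sum_distrib_left)
  ultimately show ?thesis
    using has_bochner_integral_lborel_prod[OF has_bochner_integral_std_normal_cis, of "\<lambda>i. t $ i"] by simp
qed

lemma integrable_gauss: "integrable lborel (gauss :: real^'n::finite \<Rightarrow> real)"
  and integral_gauss: "(LINT z|lborel. gauss (z :: real^'n)) = 1"
proof -
  have "has_bochner_integral lborel (\<lambda>z. complex_of_real (gauss (z :: real^'n))) (complex_of_real 1)"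
    using has_bochner_integral_gauss_cis[of 0] by simp
  then show "integrable lborel (gauss :: real^'n \<Rightarrow> real)" "(LINT z|lborel. gauss (z :: real^'n)) = 1"
    using complex_of_real_integrable_eq by (force simp: has_bochner_integral_iff)+
qed

text \<open>One substitution rule covers translations (c = 1), the reflection (c = -1) and the
  dilations by \<epsilon> and its inverse that are used below.\<close>

lemma lborel_integral_affine:
  fixes f :: "'a::euclidean_space \<Rightarrow> 'b::{banach, second_countable_topology}"
  assumes [measurable]: "f \<in> borel_measurable borel" and "c \<noteq> 0"
  shows "(LINT x|lborel. f x) = \<bar>c\<bar> ^ DIM('a) *\<^sub>R (LINT x|lborel. f (t + c *\<^sub>R x))"
  by (subst lborel_affine[OF \<open>c \<noteq> 0\<close>, of t]) (simp add: integral_density integral_distr)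

lemma lborel_integrable_affine:
  fixes f :: "'a::euclidean_space \<Rightarrow> 'b::{banach, second_countable_topology}"
  assumes "integrable lborel f" and "c \<noteq> 0"
  shows "integrable lborel (\<lambda>x. f (t + c *\<^sub>R x))"
proof -
  have [measurable]: "f \<in> borel_measurable borel"
    using assms(1) by (auto dest: borel_measurable_integrable)
  from assms(1) have "integrable (density (distr lborel borel (\<lambda>x. t + c *\<^sub>R x)) (\<lambda>_. \<bar>c\<bar> ^ DIM('a))) f"
    by (simp add: lborel_affine[OF \<open>c \<noteq> 0\<close>, symmetric])
  then have "integrable lborel (\<lambda>x. \<bar>c\<bar> ^ DIM('a) *\<^sub>R f (t + c *\<^sub>R x))"
    by (simp add: integrable_density integrable_distr_eq)
  then show ?thesis
    using \<open>c \<noteq> 0\<close> integrable_scaleR_right[of "inverse (\<bar>c\<bar> ^ DIM('a))" lborel "\<lambda>x. \<bar>c\<bar> ^ DIM('a) *\<^sub>R f (t + c *\<^sub>R x)"]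
    by simp
qed


subsection \<open>The Plancherel formula\<close>

text \<open>Unnormalised: the factor (2 pi)^n in Plancherel compensates for this, and the prefactor
  of \<open>weighted_fourier\<close> is restored only at the end.\<close>

definition fourier :: "(real^'n::finite \<Rightarrow> complex) \<Rightarrow> real^'n \<Rightarrow> complex" where
  "fourier h \<xi> = (LINT x|lborel. cis (- (\<xi> \<bullet> x)) * h x)"

lemma borel_measurable_cis [measurable]: "cis \<in> borel_measurable borel"
  by (intro borel_measurable_continuous_onI continuous_intros)

lemma borel_measurable_cnj [measurable]: "cnj \<in> borel_measurable borel"
  by (intro borel_measurable_continuous_onI continuous_intros)

lemma integrable_cis_mult:
  fixes h :: "real^'n::finite \<Rightarrow> complex"
  assumes "integrable lborel h"
  shows "integrable lborel (\<lambda>x. cis (\<xi> \<bullet> x) * h x)"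
proof (rule Bochner_Integration.integrable_bound)
  show "(\<lambda>x. cis (\<xi> \<bullet> x) * h x) \<in> borel_measurable lborel"
    using borel_measurable_integrable[OF assms] by simp
qed (use assms in \<open>auto simp: norm_mult\<close>)

lemma borel_measurable_fourier [measurable]:
  assumes [measurable]: "h \<in> borel_measurable borel"
  shows "fourier h \<in> borel_measurable borel"
  unfolding fourier_def by measurable

lemma norm_fourier_le: "norm (fourier h \<xi>) \<le> (LINT x|lborel. norm (h x))"
  unfolding fourier_def
  using integral_norm_bound[of lborel "\<lambda>x. cis (- (\<xi> \<bullet> x)) * h x"] by (simp add: norm_mult)

lemma integrable_mult_bounded:
  fixes u v :: "'a \<Rightarrow> complex"
  assumes "integrable M u" "v \<in> borel_measurable M" "\<And>x. norm (v x) \<le> B"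
  shows "integrable M (\<lambda>x. u x * v x)"
proof (rule Bochner_Integration.integrable_bound)
  show "integrable M (\<lambda>x. B *\<^sub>R u x)"
    using assms(1) by simp
  show "(\<lambda>x. u x * v x) \<in> borel_measurable M"
    using assms by simp
  have "norm (u x * v x) \<le> norm (B *\<^sub>R u x)" for x
    using mult_left_mono[OF order_trans[OF assms(3) abs_ge_self], of "norm (u x)" x]
    by (simp add: norm_mult mult.commute)
  then show "AE x in M. norm (u x * v x) \<le> norm (B *\<^sub>R u x)"
    by simp
qed

text \<open>The multiplication formula: Fubini for u(x) e^(-i x.\<xi>) v(\<xi>), whose modulus
  |u(x)| |v(\<xi>)| is integrable on the product space.\<close>

lemma integral_fourier_mult:
  fixes u v :: "real^'n::finite \<Rightarrow> complex"
  assumes u: "integrable lborel u" and v: "integrable lborel v"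
  shows "(LINT \<xi>|lborel. fourier u \<xi> * v \<xi>) = (LINT x|lborel. u x * fourier v x)"
proof -
  have [measurable]: "u \<in> borel_measurable borel" "v \<in> borel_measurable borel"
    using u v by (auto dest: borel_measurable_integrable)
  let ?F = "\<lambda>x \<xi>. u x * (cis (- (x \<bullet> \<xi>)) * v \<xi>)"
  have "integrable (lborel \<Otimes>\<^sub>M lborel) (case_prod ?F)"
  proof (rule lborel_pair.Fubini_integrable)
    show "case_prod ?F \<in> borel_measurable (lborel \<Otimes>\<^sub>M lborel)"
      by measurable
    show "integrable lborel (\<lambda>x. LINT \<xi>|lborel. norm (case_prod ?F (x, \<xi>)))"
      using u v by (simp add: norm_mult)
    show "AE x in lborel. integrable lborel (\<lambda>\<xi>. case_prod ?F (x, \<xi>))"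
      using integrable_cis_mult[OF v] by (auto simp flip: inner_minus_left)
  qed
  from lborel_pair.Fubini_integral[OF this]
  have "(LINT \<xi>|lborel. LINT x|lborel. ?F x \<xi>) = (LINT x|lborel. LINT \<xi>|lborel. ?F x \<xi>)" .
  moreover have "(LINT x|lborel. ?F x \<xi>) = fourier u \<xi> * v \<xi>" for \<xi>
  proof -
    have "(LINT x|lborel. ?F x \<xi>) = (LINT x|lborel. (cis (- (\<xi> \<bullet> x)) * u x) * v \<xi>)"
      by (intro Bochner_Integration.integral_cong) (simp_all add: inner_commute mult_ac)
    then show ?thesis
      by (simp add: fourier_def)
  qed
  moreover have "(LINT \<xi>|lborel. ?F x \<xi>) = u x * fourier v x" for x
    by (simp add: fourier_def)
  ultimately show ?thesis
    by (simp only:)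
qed

text \<open>Conjugation reverses the sign in the character and reflection reverses it back. A
  conjugated transform is thus again a transform, to which the multiplication formula
  applies.\<close>

lemma cnj_fourier:
  assumes [measurable]: "h \<in> borel_measurable borel"
  shows "cnj (fourier h \<xi>) = fourier (\<lambda>y. cnj (h (- y))) \<xi>"
proof -
  have "cnj (fourier h \<xi>) = (LINT y|lborel. cis (\<xi> \<bullet> y) * cnj (h y))"
    unfolding fourier_def Bochner_Integration.integral_cnj[symmetric]
    by (simp add: cis_cnj del: Bochner_Integration.integral_cnj)
  also have "\<dots> = fourier (\<lambda>y. cnj (h (- y))) \<xi>"
    unfolding fourier_def
    using lborel_integral_affine[of "\<lambda>y. cis (\<xi> \<bullet> y) * cnj (h y)" "-1" 0] by simp
  finally show ?thesis .
qed

text \<open>Rescaling by \<epsilon> leads to the characteristic function of the Gaussian. One factor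
  (2 pi)^(n/2) arises from writing the integrand through \<open>gauss\<close>, a second one from
  writing the result through it.\<close>

lemma fourier_scaled_gauss:
  fixes w :: "real^'n::finite"
  assumes "\<epsilon> > 0"
  shows "(LINT \<xi>|lborel. cis (- (w \<bullet> \<xi>)) * exp (- (\<epsilon> * norm \<xi>)\<^sup>2 / 2))
     = (2 * pi) ^ CARD('n) / \<epsilon> ^ CARD('n) * gauss (w /\<^sub>R \<epsilon>)"
proof -
  let ?n = "CARD('n)"
  let ?p = "(2 * pi) powr (real ?n / 2)"
  have pp: "?p * ?p = (2 * pi) ^ ?n"
    by (simp add: powr_add[symmetric] powr_realpow)
  let ?F = "\<lambda>\<xi>. cis (- (w \<bullet> \<xi>)) * complex_of_real (exp (- (\<epsilon> * norm \<xi>)\<^sup>2 / 2))"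
  have "(LINT \<xi>|lborel. ?F \<xi>) = inverse \<epsilon> ^ ?n *\<^sub>R (LINT z|lborel. ?F (z /\<^sub>R \<epsilon>))"
    using assms lborel_integral_affine[of ?F "inverse \<epsilon>" 0] by simp
  also have "(LINT z|lborel. ?F (z /\<^sub>R \<epsilon>)) = (LINT z|lborel. ?p * (cis ((- (w /\<^sub>R \<epsilon>)) \<bullet> z) * gauss z))"
    using assms
    by (intro Bochner_Integration.integral_cong) (simp_all add: gauss_eq)
  also have "\<dots> = ?p * exp (- (norm (w /\<^sub>R \<epsilon>))\<^sup>2 / 2)"
    using has_bochner_integral_gauss_cis[of "- (w /\<^sub>R \<epsilon>)"] by (simp add: has_bochner_integral_iff)
  also have "\<dots> = (2 * pi) ^ ?n * gauss (w /\<^sub>R \<epsilon>)"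
  proof -
    have "?p * exp (- (norm (w /\<^sub>R \<epsilon>))\<^sup>2 / 2) = (2 * pi) ^ ?n * gauss (w /\<^sub>R \<epsilon>)"
      unfolding gauss_eq pp[symmetric] by simp
    from arg_cong[OF this, of complex_of_real] show ?thesis
      by (simp only: of_real_mult)
  qed
  finally show ?thesis
    by (simp add: scaleR_conv_of_real field_simps)
qed

text \<open>Two uses of the multiplication formula move both transforms onto the Gaussian. What
  remains pairs h with its own conjugate, averaged by a Gaussian of width \<epsilon>.\<close>

lemma plancherel_regularised:
  fixes h :: "real^'n::finite \<Rightarrow> complex"
  assumes h: "integrable lborel h" and \<epsilon>: "\<epsilon> > 0"
  shows "integrable lborel (\<lambda>\<xi>. (norm (fourier h \<xi>))\<^sup>2 * exp (- (\<epsilon> * norm \<xi>)\<^sup>2 / 2))" (is ?int)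
    and "complex_of_real (LINT \<xi>|lborel. (norm (fourier h \<xi>))\<^sup>2 * exp (- (\<epsilon> * norm \<xi>)\<^sup>2 / 2))
       = (2 * pi) ^ CARD('n) * (LINT x|lborel. h x * (LINT z|lborel. cnj (h (x - \<epsilon> *\<^sub>R z)) * gauss z))" (is ?eq)
proof -
  let ?n = "CARD('n)"
  have [measurable]: "h \<in> borel_measurable borel"
    using h by (auto dest: borel_measurable_integrable)
  define E where "E \<xi> = complex_of_real (exp (- (\<epsilon> * norm \<xi>)\<^sup>2 / 2))" for \<xi> :: "real^'n"
  define h' where "h' y = cnj (h (- y))" for y
  have [measurable]: "E \<in> borel_measurable borel" "h' \<in> borel_measurable borel"
    unfolding E_def h'_def by measurable
  have h': "integrable lborel h'"
    using lborel_integrable_affine[OF h, of "-1" 0] by (simp add: h'_def[abs_def])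
  have E: "integrable lborel E"
  proof -
    have "integrable lborel (\<lambda>\<xi> :: real^'n. gauss (0 + \<epsilon> *\<^sub>R \<xi>))"
      using \<epsilon> by (intro lborel_integrable_affine integrable_gauss) simp
    then have "integrable lborel (\<lambda>\<xi> :: real^'n. (2 * pi) powr (real ?n / 2) * gauss (0 + \<epsilon> *\<^sub>R \<xi>))"
      by (rule integrable_mult_right)
    then show ?thesis
      unfolding E_def complex_of_real_integrable_eq by (simp add: gauss_eq power_mult_distrib)
  qed
  \<comment> \<open>Chosen so that \<open>fourier h \<xi> * v \<xi>\<close> is the damped square; it
    is integrable because the transform of h is bounded and E is integrable.\<close>
  define v where "v \<xi> = E \<xi> * cnj (fourier h \<xi>)" for \<xi>
  have v: "integrable lborel v"
    unfolding v_def using norm_fourier_le[of h]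
    by (intro integrable_mult_bounded[OF E, where B="LINT x|lborel. norm (h x)"]) auto
  have sq: "fourier h \<xi> * v \<xi> = complex_of_real ((norm (fourier h \<xi>))\<^sup>2 * exp (- (\<epsilon> * norm \<xi>)\<^sup>2 / 2))" for \<xi>
    using complex_norm_square[of "fourier h \<xi>"] by (simp add: v_def E_def mult_ac)
  have "integrable lborel (\<lambda>\<xi>. v \<xi> * fourier h \<xi>)"
    using norm_fourier_le[of h]
    by (intro integrable_mult_bounded[OF v, where B="LINT x|lborel. norm (h x)"]) auto
  then show ?int
    by (simp only: mult.commute[of "v _"] sq complex_of_real_integrable_eq)
  have v_fourier: "fourier v x = (2 * pi) ^ ?n * (LINT z|lborel. cnj (h (x - \<epsilon> *\<^sub>R z)) * gauss z)" for x
  proof -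
    have "fourier v x = (LINT \<xi>|lborel. fourier h' \<xi> * (cis (- (x \<bullet> \<xi>)) * E \<xi>))"
      by (simp add: fourier_def[of v] v_def cnj_fourier h'_def[abs_def] mult_ac)
    \<comment> \<open>The conjugated transform is the transform of \<open>h'\<close>, so the
      multiplication formula shifts the transform onto the explicitly known Gaussian.\<close>
    also have "\<dots> = (LINT y|lborel. h' y * fourier (\<lambda>\<xi>. cis (- (x \<bullet> \<xi>)) * E \<xi>) y)"
      using integrable_cis_mult[OF E, of "- x"] by (intro integral_fourier_mult h') simp
    also have "\<dots> = (LINT y|lborel. h' y * ((2 * pi) ^ ?n / \<epsilon> ^ ?n * gauss ((x + y) /\<^sub>R \<epsilon>)))"
    proof (intro Bochner_Integration.integral_cong refl arg_cong2[where f="(*)"])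
      fix y
      have "fourier (\<lambda>\<xi>. cis (- (x \<bullet> \<xi>)) * E \<xi>) y = (LINT \<xi>|lborel. cis (- ((x + y) \<bullet> \<xi>)) * E \<xi>)"
        unfolding fourier_def mult.assoc[symmetric] cis_mult by (simp add: inner_add_left add.commute)
      then show "fourier (\<lambda>\<xi>. cis (- (x \<bullet> \<xi>)) * E \<xi>) y = (2 * pi) ^ ?n / \<epsilon> ^ ?n * gauss ((x + y) /\<^sub>R \<epsilon>)"
        using fourier_scaled_gauss[OF \<epsilon>, of "x + y"] by (simp add: E_def)
    qed
    \<comment> \<open>The substitution y = -x + \<epsilon> z cancels the power of \<epsilon>, fixes
      the Gaussian and puts \<epsilon> into the argument of h, where continuity can act.\<close>
    also have "\<dots> = \<epsilon> ^ ?n *\<^sub>R (LINT z|lborel. h' (- x + \<epsilon> *\<^sub>R z) * ((2 * pi) ^ ?n / \<epsilon> ^ ?n * gauss z))"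
      using \<epsilon> lborel_integral_affine[of "\<lambda>y. h' y * ((2 * pi) ^ ?n / \<epsilon> ^ ?n * complex_of_real (gauss ((x + y) /\<^sub>R \<epsilon>)))" \<epsilon> "- x"]
      by simp
    also have "(LINT z|lborel. h' (- x + \<epsilon> *\<^sub>R z) * ((2 * pi) ^ ?n / \<epsilon> ^ ?n * gauss z))
        = (LINT z|lborel. (2 * pi) ^ ?n / \<epsilon> ^ ?n * (cnj (h (x - \<epsilon> *\<^sub>R z)) * gauss z))"
      by (intro Bochner_Integration.integral_cong) (simp_all add: h'_def)
    finally show ?thesis
      using \<epsilon> by (simp add: scaleR_conv_of_real)
  qed
  have "complex_of_real (LINT \<xi>|lborel. (norm (fourier h \<xi>))\<^sup>2 * exp (- (\<epsilon> * norm \<xi>)\<^sup>2 / 2))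
      = (LINT \<xi>|lborel. fourier h \<xi> * v \<xi>)"
    by (simp only: sq integral_complex_of_real)
  also have "\<dots> = (LINT x|lborel. h x * fourier v x)"
    by (intro integral_fourier_mult h v)
  also have "\<dots> = (LINT x|lborel. (2 * pi) ^ ?n * (h x * (LINT z|lborel. cnj (h (x - \<epsilon> *\<^sub>R z)) * gauss z)))"
    by (intro Bochner_Integration.integral_cong) (simp_all add: v_fourier)
  finally show ?eq
    by simp
qed

text \<open>On the space side, the bound B provides domination and continuity identifies the limit
  of the Gaussian averages. On the frequency side the integrals are then known to have a finite
  limit, so monotone convergence yields integrability along with the value.\<close>

theorem plancherel:
  fixes h :: "real^'n::finite \<Rightarrow> complex"
  assumes h: "integrable lborel h" and cont: "continuous_on UNIV h" and bounded: "\<And>x. norm (h x) \<le> B"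
  shows "has_bochner_integral lborel (\<lambda>\<xi>. (norm (fourier h \<xi>))\<^sup>2)
    ((2 * pi) ^ CARD('n) * (LINT x|lborel. (norm (h x))\<^sup>2))"
proof -
  have [measurable]: "h \<in> borel_measurable borel"
    using h by (auto dest: borel_measurable_integrable)
  \<comment> \<open>The damping factor increases as \<epsilon> decreases, which makes the
    convergence monotone; the shift by one keeps \<open>\<epsilon> 0\<close> positive.\<close>
  define \<epsilon> :: "nat \<Rightarrow> real" where "\<epsilon> k = inverse (Suc k)" for k
  have \<epsilon>_pos: "\<epsilon> k > 0" for k
    by (simp add: \<epsilon>_def)
  have \<epsilon>_lim: "\<epsilon> \<longlonglongrightarrow> 0"
    unfolding \<epsilon>_def by (rule LIMSEQ_inverse_real_of_nat)
  define s where "s k \<xi> = (norm (fourier h \<xi>))\<^sup>2 * exp (- (\<epsilon> k * norm \<xi>)\<^sup>2 / 2)" for k \<xi>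
  define A where "A k x = (LINT z|lborel. cnj (h (x - \<epsilon> k *\<^sub>R z)) * gauss z)" for k x
  have [measurable]: "A k \<in> borel_measurable borel" for k
    unfolding A_def by measurable
  have bound: "norm (cnj (h y) * complex_of_real (gauss z)) \<le> B * gauss z" for y and z :: "real^'n"
    using bounded[of y] gauss_nonneg[of z] by (simp add: norm_mult mult_right_mono)
  have A_lim: "(\<lambda>k. A k x) \<longlonglongrightarrow> cnj (h x)" for x
  proof -
    have "(\<lambda>k. A k x) \<longlonglongrightarrow> (LINT z|lborel. cnj (h x) * gauss (z :: real^'n))"
      unfolding A_def
    proof (rule integral_dominated_convergence)
      show "integrable lborel (\<lambda>z :: real^'n. B * gauss z)"
        by (intro integrable_mult_right integrable_gauss)
      have "(\<lambda>k. h (x - \<epsilon> k *\<^sub>R z)) \<longlonglongrightarrow> h (x - 0 *\<^sub>R z)" for z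
        by (intro continuous_on_tendsto_compose[OF cont] tendsto_intros \<epsilon>_lim) auto
      then show "AE z in lborel. (\<lambda>k. cnj (h (x - \<epsilon> k *\<^sub>R z)) * gauss z) \<longlonglongrightarrow> cnj (h x) * gauss z"
        by (intro AE_I2 tendsto_intros) simp
    qed (use bound in auto)
    then show ?thesis
      using integral_gauss[where 'n='n] by simp
  qed
  have A_bound: "norm (A k x) \<le> B" for k x
  proof -
    have "norm (A k x) \<le> (LINT z|lborel. norm (cnj (h (x - \<epsilon> k *\<^sub>R z)) * gauss z))"
      unfolding A_def by (rule integral_norm_bound)
    also have "\<dots> \<le> (LINT z|lborel. B * gauss (z :: real^'n))"
      using bound order_trans[OF norm_ge_zero bound]
      by (intro integral_mono' integrable_mult_right integrable_gauss) auto
    finally have "norm (A k x) \<le> (LINT z|lborel. B * gauss (z :: real^'n))" .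
    then show ?thesis
      using integral_gauss[where 'n='n] by simp
  qed
  have "(\<lambda>k. LINT x|lborel. h x * A k x) \<longlonglongrightarrow> (LINT x|lborel. h x * cnj (h x))"
  proof (rule integral_dominated_convergence)
    show "integrable lborel (\<lambda>x. norm (h x) * B)"
      using h by simp
    show "AE x in lborel. (\<lambda>k. h x * A k x) \<longlonglongrightarrow> h x * cnj (h x)"
      by (intro AE_I2 tendsto_intros A_lim)
    show "AE x in lborel. norm (h x * A k x) \<le> norm (h x) * B" for k
      by (intro AE_I2) (simp add: norm_mult mult_left_mono A_bound)
  qed auto
  then have "(\<lambda>k. (2 * pi) ^ CARD('n) * (LINT x|lborel. h x * A k x)) \<longlonglongrightarrow>
      (2 * pi) ^ CARD('n) * (LINT x|lborel. h x * cnj (h x))"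
    by (intro tendsto_intros)
  also have "(\<lambda>k. (2 * pi) ^ CARD('n) * (LINT x|lborel. h x * A k x)) = (\<lambda>k. complex_of_real (LINT \<xi>|lborel. s k \<xi>))"
    unfolding s_def A_def using plancherel_regularised(2)[OF h \<epsilon>_pos] by simp
  also have "(LINT x|lborel. h x * cnj (h x)) = complex_of_real (LINT x|lborel. (norm (h x))\<^sup>2)"
    by (simp add: complex_norm_square[symmetric] del: of_real_power flip: integral_complex_of_real)
  finally have "(\<lambda>k. complex_of_real (LINT \<xi>|lborel. s k \<xi>)) \<longlonglongrightarrow>
      complex_of_real ((2 * pi) ^ CARD('n) * (LINT x|lborel. (norm (h x))\<^sup>2))"
    by simp
  then have s_lim: "(\<lambda>k. LINT \<xi>|lborel. s k \<xi>) \<longlonglongrightarrow> (2 * pi) ^ CARD('n) * (LINT x|lborel. (norm (h x))\<^sup>2)"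
    unfolding tendsto_of_real_iff .
  have mono: "mono (\<lambda>k. s k \<xi>)" for \<xi>
  proof (rule monoI)
    fix k l :: nat assume "k \<le> l"
    then have "(\<epsilon> l * norm \<xi>)\<^sup>2 \<le> (\<epsilon> k * norm \<xi>)\<^sup>2"
      unfolding \<epsilon>_def by (intro power_mono mult_right_mono le_imp_inverse_le) auto
    then show "s k \<xi> \<le> s l \<xi>"
      unfolding s_def by (intro mult_left_mono) auto
  qed
  have ptw: "(\<lambda>k. s k \<xi>) \<longlonglongrightarrow> (norm (fourier h \<xi>))\<^sup>2" for \<xi>
  proof -
    have "(\<lambda>k. s k \<xi>) \<longlonglongrightarrow> (norm (fourier h \<xi>))\<^sup>2 * exp (- (0 * norm \<xi>)\<^sup>2 / 2)"
      unfolding s_def by (intro tendsto_intros \<epsilon>_lim) auto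
    then show ?thesis
      by simp
  qed
  have "integrable lborel (s k)" for k
    unfolding s_def by (rule plancherel_regularised(1)[OF h \<epsilon>_pos])
  note conv = integral_monotone_convergence_nonneg[OF this AE_I2 AE_I2 AE_I2 s_lim, of "\<lambda>\<xi>. (norm (fourier h \<xi>))\<^sup>2"]
  have "integrable lborel (\<lambda>\<xi>. (norm (fourier h \<xi>))\<^sup>2)"
    by (rule conv(1)) (use mono ptw in \<open>auto simp: s_def\<close>)
  moreover have "(LINT \<xi>|lborel. (norm (fourier h \<xi>))\<^sup>2) = (2 * pi) ^ CARD('n) * (LINT x|lborel. (norm (h x))\<^sup>2)"
    by (rule conv(2)) (use mono ptw in \<open>auto simp: s_def\<close>)
  ultimately show ?thesis
    by (simp add: has_bochner_integral_iff)
qed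

subsection \<open>Schwartz functions\<close>

text \<open>The product form is integrable in every dimension because 1/(1+t^2) is integrable on the
  line; a radial weight would need an exponent depending on n.\<close>

definition decay_weight :: "real^'n::finite \<Rightarrow> real" where
  "decay_weight x = (\<Prod>i\<in>UNIV. inverse (1 + (x $ i)\<^sup>2))"

lemma decay_weight_pos: "0 < decay_weight x"
  unfolding decay_weight_def by (intro prod_pos) (simp add: add_pos_nonneg)

lemma decay_weight_le:
  fixes x :: "real^'n::finite"
  shows "decay_weight x \<le> inverse (1 + (x $ j)\<^sup>2)"
proof -
  have "decay_weight x = inverse (1 + (x $ j)\<^sup>2) * (\<Prod>i\<in>UNIV - {j}. inverse (1 + (x $ i)\<^sup>2))"
    unfolding decay_weight_def by (rule prod.remove) auto
  also have "\<dots> \<le> inverse (1 + (x $ j)\<^sup>2) * 1"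
    by (intro mult_left_mono prod_le_1) (auto simp: inverse_le_1_iff)
  finally show ?thesis
    by simp
qed

lemma decay_weight_le_1:
  fixes x :: "real^'n::finite"
  shows "decay_weight x \<le> 1"
  unfolding decay_weight_def by (intro prod_le_1) (auto simp: inverse_le_1_iff)

text \<open>One factor of the weight pays for the multiplier x_j - a. For this reason Schwartz
  functions are compared below with the square of the weight.\<close>

lemma linear_times_decay_weight_le:
  fixes x :: "real^'n::finite"
  shows "\<bar>x $ j - a\<bar> * decay_weight x \<le> 1 + \<bar>a\<bar>"
proof -
  have "\<bar>x $ j - a\<bar> \<le> (1 + \<bar>a\<bar>) * (1 + (x $ j)\<^sup>2)"
  proof -
    have "0 \<le> (\<bar>x $ j\<bar> - 1)\<^sup>2"
      by simp
    then have "\<bar>x $ j\<bar> \<le> 1 + (x $ j)\<^sup>2"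
      by (simp add: power2_diff)
    moreover have "0 \<le> \<bar>a\<bar> * (x $ j)\<^sup>2"
      by simp
    moreover have "(1 + \<bar>a\<bar>) * (1 + (x $ j)\<^sup>2) = 1 + (x $ j)\<^sup>2 + \<bar>a\<bar> + \<bar>a\<bar> * (x $ j)\<^sup>2"
      by (simp add: algebra_simps)
    ultimately show ?thesis
      using abs_triangle_ineq4[of "x $ j" a] by linarith
  qed
  then have "\<bar>x $ j - a\<bar> * inverse (1 + (x $ j)\<^sup>2) \<le> 1 + \<bar>a\<bar>"
    by (simp add: field_simps add_pos_nonneg)
  with mult_left_mono[OF decay_weight_le[of x j] abs_ge_zero[of "x $ j - a"]] show ?thesis
    by linarith
qed

text \<open>Lets one integrable function dominate all difference quotients with step at most
  1.\<close>

lemma decay_weight_shift: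
  fixes x :: "real^'n::finite"
  assumes "\<bar>t\<bar> \<le> 1"
  shows "decay_weight (x + axis j t) \<le> 3 * decay_weight x"
proof -
  let ?R = "\<Prod>i\<in>UNIV - {j}. inverse (1 + (x $ i)\<^sup>2)"
  have "decay_weight (x + axis j t)
      = inverse (1 + (x $ j + t)\<^sup>2) * (\<Prod>i\<in>UNIV - {j}. inverse (1 + ((x + axis j t) $ i)\<^sup>2))"
    unfolding decay_weight_def by (subst prod.remove[of _ j]) auto
  also have "(\<Prod>i\<in>UNIV - {j}. inverse (1 + ((x + axis j t) $ i)\<^sup>2)) = ?R"
    by (intro prod.cong) (auto simp: axis_def)
  finally have 1: "decay_weight (x + axis j t) = inverse (1 + (x $ j + t)\<^sup>2) * ?R" .
  have 2: "decay_weight x = inverse (1 + (x $ j)\<^sup>2) * ?R"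
    unfolding decay_weight_def by (subst prod.remove[of _ j]) auto
  have "t\<^sup>2 \<le> 1"
    using assms by (simp add: abs_square_le_1)
  \<comment> \<open>Origin of the constant 3, with x for the j-th coordinate: 2 (3 (1 + (x+t)^2) -
    (1 + x^2)) = (2x + 3t)^2 + 4 - 3t^2, which is nonnegative as t^2 \<le> 1.\<close>
  moreover have "0 \<le> (2 * (x $ j) + 3 * t)\<^sup>2"
    by simp
  ultimately have "1 + (x $ j)\<^sup>2 \<le> 3 * (1 + (x $ j + t)\<^sup>2)"
    by (simp add: power2_sum power2_eq_square algebra_simps)
  then have "inverse (1 + (x $ j + t)\<^sup>2) \<le> 3 * inverse (1 + (x $ j)\<^sup>2)"
    by (simp add: field_simps add_pos_nonneg)
  then have "inverse (1 + (x $ j + t)\<^sup>2) * ?R \<le> 3 * inverse (1 + (x $ j)\<^sup>2) * ?R"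
    by (intro mult_right_mono prod_nonneg) auto
  then show ?thesis
    by (simp add: 1 2)
qed

lemma integrable_decay_weight: "integrable lborel (decay_weight :: real^'n::finite \<Rightarrow> real)"
proof -
  have "integrable lborel (\<lambda>x :: real. inverse (1 + x\<^sup>2))"
    using integrable_inverse_1_plus_square by (simp add: set_integrable_def)
  then have "has_bochner_integral lborel (\<lambda>x :: real. inverse (1 + x\<^sup>2)) (LINT x|lborel. inverse (1 + x\<^sup>2))"
    by (rule has_bochner_integral_integrable)
  from has_bochner_integral_lborel_prod[OF this, where 'n='n] show ?thesis
    unfolding decay_weight_def has_bochner_integral_iff by simp
qed

lemma integrable_decay:
  fixes F :: "real^'n::finite \<Rightarrow> 'b::{banach, second_countable_topology}"
  assumes "F \<in> borel_measurable borel" "\<And>x. norm (F x) \<le> C * decay_weight x"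
  shows "integrable lborel F"
proof (rule Bochner_Integration.integrable_bound)
  show "integrable lborel (\<lambda>x :: real^'n. C * decay_weight x)"
    by (intro integrable_mult_right integrable_decay_weight)
  show "AE x in lborel. norm (F x) \<le> norm (C * decay_weight x)"
    using order_trans[OF assms(2) abs_ge_self] by simp
qed (use assms in simp)

text \<open>Expanding the product of the 1 + x_i^4 over subsets gives monomials, each controlled by
  a Schwartz seminorm. The degree 4 matches the squared weight, and being even it keeps the
  monomials nonnegative.\<close>

lemma schwartz_decay:
  fixes g :: "real^'n::finite \<Rightarrow> complex"
  assumes "g \<in> schwartz"
  obtains C where "\<And>x. norm (iterated_partial is g x) \<le> C * (decay_weight x)\<^sup>2"
proof -
  have "\<forall>\<alpha>. \<exists>C. \<forall>x. norm ((\<Prod>i\<in>UNIV. (x $ i) ^ \<alpha> i) *\<^sub>R iterated_partial is g x) \<le> C"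
    using assms unfolding schwartz_def by blast
  then obtain K where K: "\<And>\<alpha> x. norm ((\<Prod>i\<in>UNIV. (x $ i) ^ \<alpha> i) *\<^sub>R iterated_partial is g x) \<le> K \<alpha>"
    by metis
  define \<alpha> :: "'n set \<Rightarrow> 'n \<Rightarrow> nat" where "\<alpha> X i = (if i \<in> X then 4 else 0)" for X i
  have bound: "norm (iterated_partial is g x) * (\<Prod>i\<in>UNIV. 1 + (x $ i) ^ 4) \<le> (\<Sum>X\<in>Pow UNIV. K (\<alpha> X))" for x
  proof -
    have "(\<Prod>i\<in>UNIV. (x $ i) ^ 4 + 1) = (\<Sum>X\<in>Pow UNIV. \<Prod>i\<in>X. (x $ i) ^ 4)"
      by (simp add: prod_add)
    also have "\<dots> = (\<Sum>X\<in>Pow UNIV. \<Prod>i\<in>UNIV. (x $ i) ^ \<alpha> X i)"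
      unfolding \<alpha>_def by (intro sum.cong refl prod.mono_neutral_cong_left) auto
    finally have "norm (iterated_partial is g x) * (\<Prod>i\<in>UNIV. 1 + (x $ i) ^ 4)
        = (\<Sum>X\<in>Pow UNIV. (\<Prod>i\<in>UNIV. (x $ i) ^ \<alpha> X i) * norm (iterated_partial is g x))"
      by (simp add: add.commute sum_distrib_left mult.commute)
    also have "\<dots> \<le> (\<Sum>X\<in>Pow UNIV. K (\<alpha> X))"
    proof (rule sum_mono)
      fix X
      have "(\<Prod>i\<in>UNIV. (x $ i) ^ \<alpha> X i) * norm (iterated_partial is g x)
          \<le> norm ((\<Prod>i\<in>UNIV. (x $ i) ^ \<alpha> X i) *\<^sub>R iterated_partial is g x)"
        by (simp add: mult_right_mono)
      also have "\<dots> \<le> K (\<alpha> X)"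
        by (rule K)
      finally show "(\<Prod>i\<in>UNIV. (x $ i) ^ \<alpha> X i) * norm (iterated_partial is g x) \<le> K (\<alpha> X)" .
    qed
    finally show ?thesis .
  qed
  have "norm (iterated_partial is g x) \<le> (2 ^ CARD('n) * (\<Sum>X\<in>Pow UNIV. K (\<alpha> X))) * (decay_weight x)\<^sup>2" for x
  proof -
    let ?Q = "\<Prod>i\<in>UNIV. (1 + (x $ i)\<^sup>2)\<^sup>2"
    have "?Q \<le> (\<Prod>i\<in>UNIV. 2 * (1 + (x $ i) ^ 4))"
    proof (rule prod_mono, safe)
      fix i
      \<comment> \<open>This square is the difference 2 (1 + t^4) - (1 + t^2)^2 at t = x_i; the
        factor 2 per coordinate produces the constant 2^n.\<close>
      have "0 \<le> ((x $ i)\<^sup>2 - 1)\<^sup>2"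
        by simp
      then show "(1 + (x $ i)\<^sup>2)\<^sup>2 \<le> 2 * (1 + (x $ i) ^ 4)"
        by (simp add: power2_diff power2_sum)
    qed simp
    also have "\<dots> = 2 ^ CARD('n) * (\<Prod>i\<in>UNIV. 1 + (x $ i) ^ 4)"
      by (simp only: prod.distrib prod_constant)
    finally have "norm (iterated_partial is g x) * ?Q
        \<le> norm (iterated_partial is g x) * (2 ^ CARD('n) * (\<Prod>i\<in>UNIV. 1 + (x $ i) ^ 4))"
      by (intro mult_left_mono) auto
    also have "\<dots> \<le> 2 ^ CARD('n) * (\<Sum>X\<in>Pow UNIV. K (\<alpha> X))"
      unfolding mult.left_commute[of "norm _"] by (intro mult_left_mono bound) simp
    finally have "norm (iterated_partial is g x) * ?Q \<le> 2 ^ CARD('n) * (\<Sum>X\<in>Pow UNIV. K (\<alpha> X))" .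
    then have "norm (iterated_partial is g x) * ?Q * (decay_weight x)\<^sup>2
        \<le> 2 ^ CARD('n) * (\<Sum>X\<in>Pow UNIV. K (\<alpha> X)) * (decay_weight x)\<^sup>2"
      by (rule mult_right_mono) simp
    moreover have "norm (iterated_partial is g x) * ?Q * (decay_weight x)\<^sup>2 = norm (iterated_partial is g x)"
    proof -
      have "1 + (x $ i)\<^sup>2 \<noteq> 0" for i
        using zero_le_power2[of "x $ i"] by linarith
      then have "(1 + (x $ i)\<^sup>2)\<^sup>2 * (inverse (1 + (x $ i)\<^sup>2))\<^sup>2 = 1" for i
        by (simp add: power_mult_distrib[symmetric])
      then have "?Q * (decay_weight x)\<^sup>2 = 1"
        by (simp only: decay_weight_def prod_power_distrib prod.distrib[symmetric] prod.neutral_const)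
      then show ?thesis
        by (simp only: mult.assoc mult_1_right)
    qed
    ultimately show ?thesis
      by (simp only:)
  qed
  then show ?thesis
    by (rule that)
qed

lemma smooth_iterated_partial:
  assumes "smooth g"
  shows "iterated_partial is g differentiable (at x)" "continuous_on UNIV (iterated_partial is g)"
proof -
  show diff: "iterated_partial is g differentiable (at x)" for x
    using assms by (simp add: smooth_def)
  then show "continuous_on UNIV (iterated_partial is g)"
    by (auto intro!: continuous_at_imp_continuous_on differentiable_imp_continuous_within)
qed

section \<open>Derivatives along coordinate lines and their integrals\<close>

lemma has_vector_derivative_axis:
  fixes F :: "real^'n::finite \<Rightarrow> 'b::real_normed_vector"
  assumes "F differentiable (at (x + axis j t))"
  shows "((\<lambda>s. F (x + axis j s)) has_vector_derivative partial_deriv j F (x + axis j t)) (at t)"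
proof -
  let ?D = "frechet_derivative F (at (x + axis j t))"
  have D: "(F has_derivative ?D) (at (x + axis j t))"
    using assms by (simp add: frechet_derivative_works)
  have axis: "s *\<^sub>R axis j 1 = axis j s" for s :: real
    by (simp add: vec_eq_iff axis_def)
  have "((\<lambda>s. x + s *\<^sub>R axis j 1) has_derivative (\<lambda>s. s *\<^sub>R axis j 1)) (at t)"
    by (auto intro!: derivative_eq_intros)
  then have "((\<lambda>s. x + axis j s) has_derivative axis j) (at t)"
    unfolding axis .
  from has_derivative_compose[OF this D]
  have "((\<lambda>s. F (x + axis j s)) has_derivative (\<lambda>s. ?D (axis j s))) (at t)" .
  moreover have "?D (axis j s) = s *\<^sub>R partial_deriv j F (x + axis j t)" for s
    unfolding partial_deriv_def
    using linear_scale[OF has_derivative_linear[OF D], of s "axis j 1"] by (simp only: axis)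
  ultimately show ?thesis
    by (simp add: has_vector_derivative_def)
qed

text \<open>Translation invariance makes the integral of every difference quotient vanish.\<close>

lemma integral_partial_deriv_eq_0:
  fixes F :: "real^'n::finite \<Rightarrow> complex"
  assumes diff: "\<And>x. F differentiable (at x)" and F: "integrable lborel F"
    and meas [measurable]: "partial_deriv j F \<in> borel_measurable borel"
    and bound: "\<And>x. norm (partial_deriv j F x) \<le> C * decay_weight x"
  shows "(LINT x|lborel. partial_deriv j F x) = 0"
proof -
  have [measurable]: "F \<in> borel_measurable borel"
    using F by (auto dest: borel_measurable_integrable)
  have C: "0 \<le> C"
    using order_trans[OF norm_ge_zero bound, of 0] decay_weight_pos[of "0 :: real^'n"]
    by (simp add: zero_le_mult_iff)
  have axis0: "axis j 0 = (0 :: real^'n)"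
    by (simp add: vec_eq_iff axis_def)
  \<comment> \<open>Step lengths tending to 0 but never 0, and at most 1 as the shift bound for the
    weight demands.\<close>
  define t :: "nat \<Rightarrow> real" where "t k = inverse (Suc k)" for k
  have t: "t k > 0" "t k \<le> 1" for k
    by (simp_all add: t_def inverse_le_1_iff)
  have t_lim: "filterlim t (at 0) sequentially"
    using LIMSEQ_inverse_real_of_nat t by (auto simp: filterlim_at t_def[abs_def])
  define q where "q k x = (F (x + axis j (t k)) - F x) /\<^sub>R t k" for k x
  have shift: "integrable lborel (\<lambda>x. F (x + a))" "(LINT x|lborel. F (x + a)) = (LINT x|lborel. F x)" for a
    using lborel_integrable_affine[OF F, of 1 a] lborel_integral_affine[of F 1 a] by (simp_all add: add.commute)
  have q0: "(LINT x|lborel. q k x) = 0" for k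
    unfolding q_def using shift F by simp
  have "(\<lambda>k. LINT x|lborel. q k x) \<longlonglongrightarrow> (LINT x|lborel. partial_deriv j F x)"
  proof (rule integral_dominated_convergence)
    show "integrable lborel (\<lambda>x :: real^'n. 3 * C * decay_weight x)"
      by (intro integrable_mult_right integrable_decay_weight)
    show "q k \<in> borel_measurable lborel" for k
      unfolding q_def by simp
    have "(\<lambda>k. q k x) \<longlonglongrightarrow> partial_deriv j F x" for x
    proof -
      have "((\<lambda>s. F (x + axis j s)) has_vector_derivative partial_deriv j F x) (at 0)"
        using has_vector_derivative_axis[OF diff, of x j 0] by (simp only: axis0 add_0_right)
      then have lim: "((\<lambda>s. norm (F (x + axis j s) - F x - s *\<^sub>R partial_deriv j F x) / \<bar>s\<bar>) \<longlongrightarrow> 0) (at 0)"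
        by (simp add: has_vector_derivative_def has_derivative_at axis0)
      have "norm ((F (x + axis j s) - F x) /\<^sub>R s - partial_deriv j F x)
          = norm (F (x + axis j s) - F x - s *\<^sub>R partial_deriv j F x) / \<bar>s\<bar>" if "s \<noteq> 0" for s
      proof -
        have "(F (x + axis j s) - F x) /\<^sub>R s - partial_deriv j F x
            = (F (x + axis j s) - F x - s *\<^sub>R partial_deriv j F x) /\<^sub>R s"
          using that by (simp add: scaleR_diff_right)
        then show ?thesis
          by (simp add: divide_inverse mult.commute)
      qed
      then have "((\<lambda>s. norm ((F (x + axis j s) - F x) /\<^sub>R s - partial_deriv j F x)) \<longlongrightarrow> 0) (at 0)"
        by (intro Lim_transform_eventually[OF lim]) (simp add: eventually_at_filter)
      then have "((\<lambda>s. (F (x + axis j s) - F x) /\<^sub>R s) \<longlongrightarrow> partial_deriv j F x) (at 0)"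
        by (rule LIM_zero_cancel[OF tendsto_norm_zero_cancel])
      from filterlim_compose[OF this t_lim] show ?thesis
        by (simp add: q_def)
    qed
    then show "AE x in lborel. (\<lambda>k. q k x) \<longlonglongrightarrow> partial_deriv j F x"
      by simp
    \<comment> \<open>The mean value inequality on the segment from x to x + t_k e_j; bringing the
      weight back to x costs the factor 3, uniformly in k.\<close>
    have "norm (q k x) \<le> 3 * C * decay_weight x" for k x
    proof -
      have "norm (F (x + axis j (t k)) - F (x + axis j 0)) \<le> (3 * C * decay_weight x) * norm (t k - 0)"
      proof (rule differentiable_bound[of "{0..t k}" "\<lambda>s. F (x + axis j s)" "\<lambda>s h. h *\<^sub>R partial_deriv j F (x + axis j s)"])
        fix s assume s: "s \<in> {0..t k}"
        show "((\<lambda>s. F (x + axis j s)) has_derivative (\<lambda>h. h *\<^sub>R partial_deriv j F (x + axis j s))) (at s within {0..t k})"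
          using has_vector_derivative_axis[OF diff, of x j s]
          by (auto simp: has_vector_derivative_def intro: has_derivative_at_withinI)
        have "norm (partial_deriv j F (x + axis j s)) \<le> C * decay_weight (x + axis j s)"
          by (rule bound)
        also have "\<dots> \<le> C * (3 * decay_weight x)"
          using s t(2)[of k] by (intro mult_left_mono decay_weight_shift C) auto
        finally have le: "norm (partial_deriv j F (x + axis j s)) \<le> 3 * C * decay_weight x"
          by (simp add: mult_ac)
        show "onorm (\<lambda>h. h *\<^sub>R partial_deriv j F (x + axis j s)) \<le> 3 * C * decay_weight x"
          by (intro onorm_le) (simp add: mult_left_mono[OF le] mult.commute[of _ "\<bar>_\<bar>"])
      qed (use t(1)[of k] in auto)
      then show ?thesis
        using t(1)[of k] by (simp add: q_def axis0 divide_simps)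
    qed
    then show "AE x in lborel. norm (q k x) \<le> 3 * C * decay_weight x" for k
      by simp
  qed simp
  then show ?thesis
    by (simp add: q0 LIMSEQ_const_iff)
qed

subsection \<open>The uncertainty principle for one coordinate\<close>

lemma partial_deriv_eq:
  "(F has_derivative D) (at x) \<Longrightarrow> partial_deriv j F x = D (axis j 1)"
  by (simp add: partial_deriv_def frechet_derivative_at[symmetric])

lemma has_derivative_partial:
  "F differentiable (at x) \<Longrightarrow> \<exists>D. (F has_derivative D) (at x) \<and> D (axis j 1) = partial_deriv j F x"
  by (metis differentiable_def partial_deriv_eq)

text \<open>The product rule for F = e^(-i \<xi>.x) g gives two terms, and the integral of the j-th
  partial derivative of F vanishes.\<close>

lemma fourier_partial_deriv:
  fixes g :: "real^'n::finite \<Rightarrow> complex"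
  assumes diff: "\<And>x. g differentiable (at x)"
    and [measurable]: "g \<in> borel_measurable borel" "partial_deriv j g \<in> borel_measurable borel"
    and g: "\<And>x. norm (g x) \<le> C * decay_weight x"
    and dg: "\<And>x. norm (partial_deriv j g x) \<le> C' * decay_weight x"
  shows "fourier (partial_deriv j g) \<xi> = \<i> * complex_of_real (\<xi> $ j) * fourier g \<xi>"
proof -
  define F where "F x = cis (- (\<xi> \<bullet> x)) * g x" for x
  have F: "F differentiable (at x)"
      "partial_deriv j F x = cis (- (\<xi> \<bullet> x)) * partial_deriv j g x - \<i> * complex_of_real (\<xi> $ j) * (cis (- (\<xi> \<bullet> x)) * g x)" for x
  proof -
    obtain D where D: "(g has_derivative D) (at x)" "D (axis j 1) = partial_deriv j g x"
      using has_derivative_partial[OF diff] by blast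
    have "((\<lambda>x. cis (- (\<xi> \<bullet> x))) has_derivative (\<lambda>v. - \<i> * complex_of_real (\<xi> \<bullet> v) * cis (- (\<xi> \<bullet> x)))) (at x)"
    proof -
      have "((\<lambda>x. - \<i> * complex_of_real (\<xi> \<bullet> x)) has_derivative (\<lambda>v. - \<i> * complex_of_real (\<xi> \<bullet> v))) (at x)"
        by (auto intro!: derivative_eq_intros)
      from has_derivative_compose[OF this DERIV_exp[unfolded has_field_derivative_def]] show ?thesis
        by (simp add: cis_conv_exp mult.commute)
    qed
    from has_derivative_mult[OF this D(1)]
    have "(F has_derivative (\<lambda>v. cis (- (\<xi> \<bullet> x)) * D v + - \<i> * complex_of_real (\<xi> \<bullet> v) * cis (- (\<xi> \<bullet> x)) * g x)) (at x)"
      unfolding F_def .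
    from this partial_deriv_eq[OF this, of j]
    show "F differentiable (at x)"
      "partial_deriv j F x = cis (- (\<xi> \<bullet> x)) * partial_deriv j g x - \<i> * complex_of_real (\<xi> $ j) * (cis (- (\<xi> \<bullet> x)) * g x)"
      by (auto simp: differentiable_def D(2) inner_axis mult_ac)
  qed
  have int: "integrable lborel g" "integrable lborel (partial_deriv j g)"
    using g dg by (auto intro!: integrable_decay)
  have "(LINT x|lborel. partial_deriv j F x) = 0"
  proof (rule integral_partial_deriv_eq_0)
    show "integrable lborel F"
      unfolding F_def using integrable_cis_mult[OF int(1), of "- \<xi>"] by simp
    show "partial_deriv j F \<in> borel_measurable borel"
      unfolding F(2)[abs_def] by measurable
    show "norm (partial_deriv j F x) \<le> (C' + \<bar>\<xi> $ j\<bar> * C) * decay_weight x" for x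
    proof -
      have "norm (partial_deriv j F x) \<le> norm (partial_deriv j g x) + \<bar>\<xi> $ j\<bar> * norm (g x)"
        unfolding F(2) by (rule norm_triangle_ineq4[THEN order_trans]) (simp add: norm_mult)
      also have "\<dots> \<le> C' * decay_weight x + \<bar>\<xi> $ j\<bar> * (C * decay_weight x)"
        by (intro add_mono mult_left_mono g dg) auto
      finally show ?thesis
        by (simp add: algebra_simps)
    qed
  qed (rule F(1))
  moreover have "(LINT x|lborel. partial_deriv j F x)
      = fourier (partial_deriv j g) \<xi> - \<i> * complex_of_real (\<xi> $ j) * fourier g \<xi>"
    unfolding F(2) fourier_def
    using integrable_cis_mult[OF int(1), of "- \<xi>"] integrable_cis_mult[OF int(2), of "- \<xi>"] by simp
  ultimately show ?thesis
    by simp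
qed

section \<open>Decay and integrability of products\<close>

lemma mult_decay_le:
  assumes "u \<le> C * decay_weight x" "v \<le> D * decay_weight x" "0 \<le> u" "0 \<le> v"
  shows "u * v \<le> C * D * decay_weight x"
proof -
  have CD: "0 \<le> C * decay_weight x" "0 \<le> D * decay_weight x"
    using assms by linarith+
  then have "0 \<le> C" "0 \<le> D"
    using decay_weight_pos[of x] by (simp_all add: zero_le_mult_iff)
  have "u * v \<le> (C * decay_weight x) * (D * decay_weight x)"
    using assms CD by (intro mult_mono) auto
  also have "\<dots> = (C * D * decay_weight x) * decay_weight x"
    by (simp add: mult_ac)
  also have "\<dots> \<le> C * D * decay_weight x"
    using \<open>0 \<le> C\<close> \<open>0 \<le> D\<close> decay_weight_pos[of x] decay_weight_le_1[of x] by (intro mult_left_le) auto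
  finally show ?thesis .
qed

text \<open>Of the two weight factors available, one absorbs the multiplier and the other remains
  for integrability. A single constant serves the multipliers 1 and |x_j - a|.\<close>

lemma schwartz_decay_linear:
  fixes g :: "real^'n::finite \<Rightarrow> complex" and a :: real
  assumes "g \<in> schwartz"
  obtains C where "\<And>x. norm (iterated_partial is g x) \<le> C * decay_weight x"
    "\<And>x. \<bar>x $ j - a\<bar> * norm (iterated_partial is g x) \<le> C * decay_weight x"
proof -
  obtain K where K: "\<And>x. norm (iterated_partial is g x) \<le> K * (decay_weight x)\<^sup>2"
    using schwartz_decay[OF assms, of "is"] by blast
  have "0 \<le> K"
    using order_trans[OF norm_ge_zero K, of 0] decay_weight_pos[of "0 :: real^'n"]
    by (simp add: zero_le_mult_iff)
  show ?thesis
  proof (rule that)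
    fix x
    have le: "c * norm (iterated_partial is g x) \<le> (1 + \<bar>a\<bar>) * K * decay_weight x"
      if "0 \<le> c" "c * decay_weight x \<le> 1 + \<bar>a\<bar>" for c
    proof -
      have "c * norm (iterated_partial is g x) \<le> c * (K * (decay_weight x)\<^sup>2)"
        using that by (intro mult_left_mono K) auto
      also have "\<dots> = (c * decay_weight x) * (K * decay_weight x)"
        by (simp add: power2_eq_square mult_ac)
      also have "\<dots> \<le> (1 + \<bar>a\<bar>) * (K * decay_weight x)"
        using \<open>0 \<le> K\<close> decay_weight_pos[of x] that by (intro mult_right_mono) auto
      finally show ?thesis
        by (simp add: mult_ac)
    qed
    show "norm (iterated_partial is g x) \<le> (1 + \<bar>a\<bar>) * K * decay_weight x"
      using le[of 1] decay_weight_le_1[of x] by simp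
    show "\<bar>x $ j - a\<bar> * norm (iterated_partial is g x) \<le> (1 + \<bar>a\<bar>) * K * decay_weight x"
      by (intro le linear_times_decay_weight_le) simp
  qed
qed

lemma schwartz_continuous:
  assumes "g \<in> schwartz"
  shows "continuous_on UNIV (iterated_partial is g)"
  using assms by (intro smooth_iterated_partial(2)) (simp add: schwartz_def)

lemma schwartz_integrable:
  fixes g :: "real^'n::finite \<Rightarrow> complex"
  assumes g: "g \<in> schwartz"
  shows "integrable lborel g" "integrable lborel (\<lambda>x. (norm (g x))\<^sup>2)"
    "integrable lborel (\<lambda>x. (x $ j - a)\<^sup>2 * (norm (g x))\<^sup>2)"
proof -
  have it: "iterated_partial [] g = g"
    by (simp add: iterated_partial_def)
  obtain C where C: "\<And>x. norm (g x) \<le> C * decay_weight x" "\<And>x. \<bar>x $ j - a\<bar> * norm (g x) \<le> C * decay_weight x"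
    using schwartz_decay_linear[OF g, of "[]" j a] unfolding it by metis
  have [measurable]: "g \<in> borel_measurable borel"
    using schwartz_continuous[OF g, of "[]"] by (simp add: it borel_measurable_continuous_onI)
  show "integrable lborel g"
    using C(1) by (intro integrable_decay) auto
  show "integrable lborel (\<lambda>x. (norm (g x))\<^sup>2)"
    using mult_decay_le[OF C(1) C(1)] by (intro integrable_decay) (auto simp: power2_eq_square)
  have eq: "(x $ j - a)\<^sup>2 * (norm (g x))\<^sup>2 = (\<bar>x $ j - a\<bar> * norm (g x))\<^sup>2" for x
    by (simp add: power_mult_distrib)
  show "integrable lborel (\<lambda>x. (x $ j - a)\<^sup>2 * (norm (g x))\<^sup>2)"
    unfolding eq using mult_decay_le[OF C(2) C(2)] by (intro integrable_decay) (auto simp: power2_eq_square)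
qed

lemma cauchy_schwarz_integral:
  fixes u v :: "'a \<Rightarrow> real"
  assumes [measurable]: "u \<in> borel_measurable M" "v \<in> borel_measurable M"
    and nonneg: "\<And>x. 0 \<le> u x" "\<And>x. 0 \<le> v x"
    and int: "integrable M (\<lambda>x. (u x)\<^sup>2)" "integrable M (\<lambda>x. (v x)\<^sup>2)" "integrable M (\<lambda>x. u x * v x)"
  shows "(LINT x|M. u x * v x) \<le> sqrt (LINT x|M. (u x)\<^sup>2) * sqrt (LINT x|M. (v x)\<^sup>2)"
proof -
  have "ennreal ((LINT x|M. u x * v x)\<^sup>2) = (\<integral>\<^sup>+x. ennreal (u x) * ennreal (v x) \<partial>M)\<^sup>2"
    using int(3) nonneg by (simp add: nn_integral_eq_integral ennreal_power flip: ennreal_mult)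
  also have "\<dots> \<le> (\<integral>\<^sup>+x. (ennreal (u x))\<^sup>2 \<partial>M) * (\<integral>\<^sup>+x. (ennreal (v x))\<^sup>2 \<partial>M)"
    by (rule Cauchy_Schwarz_nn_integral) auto
  also have "\<dots> = ennreal ((LINT x|M. (u x)\<^sup>2) * (LINT x|M. (v x)\<^sup>2))"
    using int nonneg by (simp add: nn_integral_eq_integral ennreal_power ennreal_mult)
  finally have "(LINT x|M. u x * v x)\<^sup>2 \<le> (LINT x|M. (u x)\<^sup>2) * (LINT x|M. (v x)\<^sup>2)"
    by (subst (asm) ennreal_le_iff) (auto intro!: mult_nonneg_nonneg)
  from real_le_rsqrt[OF this] show ?thesis
    by (simp add: real_sqrt_mult)
qed

text \<open>Centring costs nothing: x_j - a still has derivative 1, and the term i m g does not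
  affect the derivative of |g|^2. The bound 1/2 stems from the factor 2 in d_j |g|^2 = 2 Re (cnj g
  d_j g).\<close>

lemma uncertainty_schwartz:
  fixes g :: "real^'n::finite \<Rightarrow> complex" and a m :: real
  assumes g: "g \<in> schwartz" and unit: "(LINT x|lborel. (norm (g x))\<^sup>2) = 1"
  shows "1 / 2 \<le> sqrt (LINT x|lborel. (x $ j - a)\<^sup>2 * (norm (g x))\<^sup>2) *
    sqrt (LINT \<xi>|lborel. (\<xi> $ j - m)\<^sup>2 * (norm (fourier g \<xi>))\<^sup>2 / (2 * pi) ^ CARD('n))"
proof -
  have smooth: "smooth g"
    using g by (simp add: schwartz_def)
  have it: "iterated_partial [] g = g" "iterated_partial [j] g = partial_deriv j g"
    by (auto simp: iterated_partial_def)
  obtain C where g_le: "\<And>x. norm (g x) \<le> C * decay_weight x"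
    and xg_le: "\<And>x. \<bar>x $ j - a\<bar> * norm (g x) \<le> C * decay_weight x"
    using schwartz_decay_linear[OF g, of "[]" j a] unfolding it by metis
  obtain C' where dg_le: "\<And>x. norm (partial_deriv j g x) \<le> C' * decay_weight x"
    using schwartz_decay_linear[OF g, of "[j]" j 0] unfolding it by metis
  have diff: "g differentiable (at x)" for x
    using smooth_iterated_partial(1)[OF smooth, of "[]"] by (simp add: it)
  have cont: "continuous_on UNIV g" "continuous_on UNIV (partial_deriv j g)"
    using schwartz_continuous[OF g, of "[]"] schwartz_continuous[OF g, of "[j]"] by (simp_all add: it)
  have [measurable]: "g \<in> borel_measurable borel" "partial_deriv j g \<in> borel_measurable borel"
    using cont by (auto intro: borel_measurable_continuous_onI)
  have int: "integrable lborel g" "integrable lborel (partial_deriv j g)"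
    using g_le dg_le by (auto intro!: integrable_decay)

  \<comment> \<open>Subtracting i m g translates the frequency variable by m, so the integral of
    |h|^2 becomes the momentum dispersion about m.\<close>
  define h where "h x = partial_deriv j g x - \<i> * complex_of_real m * g x" for x
  have h_cont: "continuous_on UNIV h"
    unfolding h_def by (intro continuous_intros cont)
  then have [measurable]: "h \<in> borel_measurable borel"
    by (rule borel_measurable_continuous_onI)
  define D where "D = C' + \<bar>m\<bar> * C"
  have h_le: "norm (h x) \<le> D * decay_weight x" for x
  proof -
    have "norm (h x) \<le> norm (partial_deriv j g x) + \<bar>m\<bar> * norm (g x)"
      unfolding h_def by (rule norm_triangle_ineq4[THEN order_trans]) (simp add: norm_mult)
    also have "\<dots> \<le> C' * decay_weight x + \<bar>m\<bar> * (C * decay_weight x)"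
      by (intro add_mono mult_left_mono g_le dg_le) auto
    finally show ?thesis
      by (simp add: D_def algebra_simps)
  qed
  have "0 \<le> D"
    using order_trans[OF norm_ge_zero h_le, of 0] decay_weight_pos[of "0 :: real^'n"]
    by (simp add: zero_le_mult_iff)
  then have h_le_const: "norm (h x) \<le> D" for x
    using h_le[of x] mult_left_mono[OF decay_weight_le_1[of x], of D] by simp
  have h_int: "integrable lborel h"
    using h_le by (auto intro!: integrable_decay)
  have fourier_h: "fourier h \<xi> = \<i> * complex_of_real (\<xi> $ j - m) * fourier g \<xi>" for \<xi>
  proof -
    have "fourier h \<xi> = fourier (partial_deriv j g) \<xi> - \<i> * complex_of_real m * fourier g \<xi>"
    proof -
      have "fourier h \<xi> = (LINT x|lborel. cis ((- \<xi>) \<bullet> x) * partial_deriv j g x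
          - \<i> * complex_of_real m * (cis ((- \<xi>) \<bullet> x) * g x))"
        unfolding fourier_def h_def by (intro Bochner_Integration.integral_cong) (simp_all add: algebra_simps)
      then show ?thesis
        using integrable_cis_mult[OF int(1), of "- \<xi>"] integrable_cis_mult[OF int(2), of "- \<xi>"]
        by (simp add: fourier_def)
    qed
    also have "fourier (partial_deriv j g) \<xi> = \<i> * complex_of_real (\<xi> $ j) * fourier g \<xi>"
      by (rule fourier_partial_deriv[OF diff _ _ g_le dg_le]) auto
    finally show ?thesis
      by (simp add: algebra_simps)
  qed
  have norm_fourier_h: "(norm (fourier h \<xi>))\<^sup>2 = (\<xi> $ j - m)\<^sup>2 * (norm (fourier g \<xi>))\<^sup>2" for \<xi>
    by (simp add: fourier_h norm_mult power_mult_distrib flip: of_real_diff)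
  have momentum: "(LINT \<xi>|lborel. (\<xi> $ j - m)\<^sup>2 * (norm (fourier g \<xi>))\<^sup>2 / (2 * pi) ^ CARD('n))
      = (LINT x|lborel. (norm (h x))\<^sup>2)"
    using plancherel[OF h_int h_cont h_le_const] unfolding norm_fourier_h
    by (simp add: has_bochner_integral_iff)

  define F where "F x = complex_of_real (x $ j - a) * (g x * cnj (g x))" for x
  have F: "F differentiable (at x)"
    "partial_deriv j F x = complex_of_real ((norm (g x))\<^sup>2 + 2 * (x $ j - a) * Re (cnj (g x) * h x))" for x
  proof -
    obtain D where D: "(g has_derivative D) (at x)" "D (axis j 1) = partial_deriv j g x"
      using has_derivative_partial[OF diff] by blast
    have "((\<lambda>x. complex_of_real (x $ j - a)) has_derivative (\<lambda>v. complex_of_real (v $ j))) (at x)"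
      by (auto intro!: derivative_eq_intros bounded_linear.has_derivative[OF bounded_linear_vec_nth])
    moreover have "((\<lambda>x. g x * cnj (g x)) has_derivative (\<lambda>v. g x * cnj (D v) + D v * cnj (g x))) (at x)"
      by (intro has_derivative_mult D(1) has_derivative_cnj)
    ultimately have F': "(F has_derivative (\<lambda>v. complex_of_real (x $ j - a) * (g x * cnj (D v) + D v * cnj (g x))
        + complex_of_real (v $ j) * (g x * cnj (g x)))) (at x)"
      unfolding F_def by (rule has_derivative_mult)
    then show "F differentiable (at x)"
      by (auto simp: differentiable_def)
    have sq: "g x * cnj (g x) = complex_of_real ((norm (g x))\<^sup>2)"
      by (rule complex_norm_square[symmetric])
    \<comment> \<open>Replacing the derivative by \<open>h\<close> is harmless because cnj g times i
      m g is purely imaginary.\<close>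
    have cross: "g x * cnj (partial_deriv j g x) + partial_deriv j g x * cnj (g x)
        = complex_of_real (2 * Re (cnj (g x) * h x))"
      by (simp add: complex_eq_iff h_def algebra_simps)
    show "partial_deriv j F x = complex_of_real ((norm (g x))\<^sup>2 + 2 * (x $ j - a) * Re (cnj (g x) * h x))"
      unfolding partial_deriv_eq[OF F'] D(2) sq cross by (simp add: algebra_simps)
  qed
  note g2_int = schwartz_integrable(2)[OF g]
  have uv_le: "\<bar>x $ j - a\<bar> * norm (g x) * norm (h x) \<le> C * D * decay_weight x" for x
    by (rule mult_decay_le[OF xg_le h_le]) auto
  have re_le: "\<bar>2 * (x $ j - a) * Re (cnj (g x) * h x)\<bar> \<le> 2 * (\<bar>x $ j - a\<bar> * norm (g x) * norm (h x))" for x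
  proof -
    have "\<bar>Re (cnj (g x) * h x)\<bar> \<le> norm (g x) * norm (h x)"
      using abs_Re_le_cmod[of "cnj (g x) * h x"] by (simp only: norm_mult complex_mod_cnj)
    then have "2 * (\<bar>x $ j - a\<bar> * \<bar>Re (cnj (g x) * h x)\<bar>) \<le> 2 * (\<bar>x $ j - a\<bar> * (norm (g x) * norm (h x)))"
      by (intro mult_left_mono) auto
    then show ?thesis
      by (simp only: abs_mult abs_numeral mult.assoc)
  qed
  have uv_int: "integrable lborel (\<lambda>x. \<bar>x $ j - a\<bar> * norm (g x) * norm (h x))"
    using uv_le by (intro integrable_decay) auto
  have re_int: "integrable lborel (\<lambda>x. 2 * (x $ j - a) * Re (cnj (g x) * h x))"
    using re_le by (intro Bochner_Integration.integrable_bound[OF integrable_mult_right[OF uv_int, of 2]])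
      (auto intro: order_trans[OF _ abs_ge_self])
  have "(LINT x|lborel. partial_deriv j F x) = 0"
  proof (rule integral_partial_deriv_eq_0[OF F(1)])
    show "integrable lborel F"
    proof (rule integrable_decay)
      show "F \<in> borel_measurable borel"
        unfolding F_def by measurable
      show "norm (F x) \<le> C * C * decay_weight x" for x
        using mult_decay_le[OF xg_le g_le, of x] by (simp add: F_def norm_mult mult_ac flip: of_real_diff)
    qed
    show "partial_deriv j F \<in> borel_measurable borel"
      unfolding F(2)[abs_def] by measurable
    show "norm (partial_deriv j F x) \<le> (C * C + 2 * (C * D)) * decay_weight x" for x
    proof -
      have "norm (partial_deriv j F x) \<le> (norm (g x))\<^sup>2 + \<bar>2 * (x $ j - a) * Re (cnj (g x) * h x)\<bar>"
        unfolding F(2) norm_of_real by (rule abs_triangle_ineq[THEN order_trans]) simp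
      also have "\<dots> \<le> C * C * decay_weight x + 2 * (C * D * decay_weight x)"
        using re_le[of x] uv_le[of x] mult_decay_le[OF g_le g_le, of x] unfolding power2_eq_square by simp
      finally show ?thesis
        by (simp add: algebra_simps)
    qed
  qed
  then have "(LINT x|lborel. (norm (g x))\<^sup>2 + 2 * (x $ j - a) * Re (cnj (g x) * h x)) = 0"
    unfolding F(2) integral_complex_of_real of_real_eq_0_iff .
  then have "1 = - (LINT x|lborel. 2 * (x $ j - a) * Re (cnj (g x) * h x))"
    using unit g2_int re_int by simp
  also have "\<dots> = (LINT x|lborel. - (2 * (x $ j - a) * Re (cnj (g x) * h x)))"
    by simp
  also have "\<dots> \<le> (LINT x|lborel. 2 * (\<bar>x $ j - a\<bar> * norm (g x) * norm (h x)))"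
  proof (rule integral_mono)
    show "- (2 * (x $ j - a) * Re (cnj (g x) * h x)) \<le> 2 * (\<bar>x $ j - a\<bar> * norm (g x) * norm (h x))" for x
      using re_le[of x] by linarith
  qed (use re_int uv_int in auto)
  also have "\<dots> = 2 * (LINT x|lborel. \<bar>x $ j - a\<bar> * norm (g x) * norm (h x))"
    by simp
  also have "(LINT x|lborel. \<bar>x $ j - a\<bar> * norm (g x) * norm (h x))
      \<le> sqrt (LINT x|lborel. (\<bar>x $ j - a\<bar> * norm (g x))\<^sup>2) * sqrt (LINT x|lborel. (norm (h x))\<^sup>2)"
  proof (rule cauchy_schwarz_integral)
    show "integrable lborel (\<lambda>x. (\<bar>x $ j - a\<bar> * norm (g x))\<^sup>2)"
      using schwartz_integrable(3)[OF g, of j a] by (simp add: power_mult_distrib)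
    show "integrable lborel (\<lambda>x. (norm (h x))\<^sup>2)"
      using mult_decay_le[OF h_le h_le] by (intro integrable_decay) (auto simp: power2_eq_square)
  qed (use uv_int in auto)
  finally show ?thesis
    unfolding momentum by (simp add: power_mult_distrib)
qed

subsection \<open>Transfer to the weighted space\<close>

lemma complex_integral_change_of_variables_bij:
  fixes \<phi> :: "real^'n::finite \<Rightarrow> real^'n" and h :: "real^'n \<Rightarrow> complex"
  assumes "bij \<phi>" "\<And>x. \<phi> differentiable (at x)" "jacobian_det \<phi> \<in> borel_measurable borel"
    and h: "integrable lborel h"
  shows "(LINT x|lborel. complex_of_real \<bar>jacobian_det \<phi> x\<bar> * h (\<phi> x)) = (LINT y|lborel. h y)"
proof -
  have parts: "integrable lborel (\<lambda>y. Re (h y))" "integrable lborel (\<lambda>y. Im (h y))"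
    using h by auto
  note cov = integral_change_of_variables_bij[OF assms(1-3)]
  have "integrable lborel (\<lambda>x. complex_of_real (\<bar>jacobian_det \<phi> x\<bar> * Re (h (\<phi> x)))
      + \<i> * complex_of_real (\<bar>jacobian_det \<phi> x\<bar> * Im (h (\<phi> x))))"
    by (intro Bochner_Integration.integrable_add integrable_mult_right integrable_of_real cov(1) parts)
  also have "(\<lambda>x. complex_of_real (\<bar>jacobian_det \<phi> x\<bar> * Re (h (\<phi> x)))
      + \<i> * complex_of_real (\<bar>jacobian_det \<phi> x\<bar> * Im (h (\<phi> x))))
      = (\<lambda>x. complex_of_real \<bar>jacobian_det \<phi> x\<bar> * h (\<phi> x))"
    by (simp add: fun_eq_iff complex_eq_iff)
  finally have int: "integrable lborel (\<lambda>x. complex_of_real \<bar>jacobian_det \<phi> x\<bar> * h (\<phi> x))" .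
  show ?thesis
    using cov(2)[OF parts(1)] cov(2)[OF parts(2)] h int
    by (simp add: complex_eq_iff flip: integral_Re integral_Im)
qed

text \<open>By the Leibniz formula the determinant is a polynomial in components of the partial
  derivatives, which are continuous.\<close>

lemma borel_measurable_jacobian_det:
  fixes \<phi> :: "real^'n::finite \<Rightarrow> real^'n"
  assumes "smooth \<phi>"
  shows "jacobian_det \<phi> \<in> borel_measurable borel"
proof -
  have cont: "continuous_on UNIV (partial_deriv j \<phi>)" for j
    using smooth_iterated_partial(2)[OF assms, of "[j]"] by (simp add: iterated_partial_def)
  have [measurable]: "(\<lambda>x. partial_deriv j \<phi> x $ i) \<in> borel_measurable borel" for i j
    by (intro borel_measurable_continuous_onI continuous_intros cont)
  have "jacobian_det \<phi> = (\<lambda>x. \<Sum>p | p permutes UNIV. of_int (sign p) * (\<Prod>i\<in>UNIV. partial_deriv (p i) \<phi> x $ i))"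
    by (simp add: fun_eq_iff jacobian_det_def jacobian_def det_def matrix_def partial_deriv_def)
  also have "\<dots> \<in> borel_measurable borel"
    by measurable
  finally show ?thesis .
qed

theorem theorem5p4:
  fixes \<phi> :: "real^'n::finite \<Rightarrow> real^'n"
    and \<omega> f :: "real^'n \<Rightarrow> complex"
  assumes "diffeomorphism \<phi>"
    and "\<And>x. \<bar>jacobian_det \<phi> x\<bar> \<noteq> 0"
    and "smooth \<omega>"
    and "\<And>x. \<omega> x \<noteq> 0"
    and "f \<in> weighted_schwartz \<phi> \<omega>"
    and "weighted_norm \<phi> \<omega> f = 1"
  shows "(\<Sum>j\<in>UNIV. dispersion_position \<phi> \<omega> f j) * (\<Sum>j\<in>UNIV. dispersion_momentum \<phi> \<omega> f j)
           \<ge> (real CARD('n))\<^sup>2 / 4"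
proof -
  have bij: "bij \<phi>" and smooth: "smooth \<phi>"
    using assms(1) by (auto simp: diffeomorphism_def)
  have diff: "\<phi> differentiable (at x)" for x
    using smooth_iterated_partial(1)[OF smooth, of "[]"] by (simp add: iterated_partial_def)
  note cov = integral_change_of_variables_bij(2)[OF bij diff borel_measurable_jacobian_det[OF smooth]]
  note complex_cov = complex_integral_change_of_variables_bij[OF bij diff borel_measurable_jacobian_det[OF smooth]]
  define g where "g = (\<lambda>x. \<omega> x * f x) \<circ> inv \<phi>"
  have g: "g \<in> schwartz"
    using assms(5) by (simp add: weighted_schwartz_def g_def)
  have g_\<phi>: "g (\<phi> x) = \<omega> x * f x" for x
    using bij by (simp add: g_def bij_is_inj)
  have norm_g: "(norm (g (\<phi> x)))\<^sup>2 = (norm (f x))\<^sup>2 * (norm (\<omega> x))\<^sup>2" for x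
    by (simp add: g_\<phi> norm_mult power_mult_distrib)
  have "weighted_inner \<phi> \<omega> f f = (LINT x|lborel. complex_of_real (\<bar>jacobian_det \<phi> x\<bar> * (norm (g (\<phi> x)))\<^sup>2))"
    unfolding weighted_inner_def norm_g
    by (intro Bochner_Integration.integral_cong) (simp_all add: complex_norm_square[symmetric] mult_ac del: of_real_power)
  also have "\<dots> = complex_of_real (LINT y|lborel. (norm (g y))\<^sup>2)"
    unfolding integral_complex_of_real by (simp only: cov[OF schwartz_integrable(2)[OF g]])
  finally have unit: "(LINT y|lborel. (norm (g y))\<^sup>2) = 1"
    using assms(6) by (simp add: weighted_norm_def)
  have fourier: "weighted_fourier \<phi> \<omega> f \<xi> = complex_of_real (1 / (2 * pi) powr (real CARD('n) / 2)) * fourier g \<xi>" for \<xi>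
  proof -
    have "fourier g \<xi> = (LINT x|lborel. complex_of_real \<bar>jacobian_det \<phi> x\<bar> * (cis (- (\<xi> \<bullet> \<phi> x)) * g (\<phi> x)))"
      unfolding fourier_def
      using complex_cov[OF integrable_cis_mult[OF schwartz_integrable(1)[OF g], of "- \<xi>"]] by simp
    also have "\<dots> = (LINT x|lborel. exp (- \<i> * complex_of_real (\<xi> \<bullet> \<phi> x)) * \<omega> x * f x * complex_of_real \<bar>jacobian_det \<phi> x\<bar>)"
      by (intro Bochner_Integration.integral_cong) (simp_all add: g_\<phi> cis_conv_exp mult_ac)
    finally show ?thesis
      by (simp add: weighted_fourier_def)
  qed
  have norm_fourier: "(norm (weighted_fourier \<phi> \<omega> f \<xi>))\<^sup>2 = (norm (fourier g \<xi>))\<^sup>2 / (2 * pi) ^ CARD('n)" for \<xi>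
  proof -
    \<comment> \<open>The squared prefactor of \<open>weighted_fourier\<close> is exactly the
      division by (2 pi)^n in the one-coordinate inequality.\<close>
    have "((2 * pi) powr (real CARD('n) / 2))\<^sup>2 = (2 * pi) ^ CARD('n)"
      by (simp add: power2_eq_square powr_add[symmetric] powr_realpow)
    then show ?thesis
      unfolding fourier norm_mult power_mult_distrib norm_of_real by (simp add: power_divide)
  qed
  let ?a = "dispersion_position \<phi> \<omega> f" and ?b = "dispersion_momentum \<phi> \<omega> f"
  have nonneg: "0 \<le> ?a j" "0 \<le> ?b j" for j
    by (auto simp: dispersion_position_def dispersion_momentum_def)
  have ab: "1 / 2 \<le> ?a j * ?b j" for j
  proof -
    have "?a j = sqrt (LINT y|lborel. (y $ j - Re (mean_position \<phi> \<omega> f j))\<^sup>2 * (norm (g y))\<^sup>2)"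
      unfolding dispersion_position_def cov[OF schwartz_integrable(3)[OF g], symmetric] norm_g
      by (intro arg_cong[where f=sqrt] Bochner_Integration.integral_cong) (simp_all add: mult_ac)
    moreover have "?b j = sqrt (LINT \<xi>|lborel. (\<xi> $ j - Re (mean_momentum \<phi> \<omega> f j))\<^sup>2 *
        (norm (fourier g \<xi>))\<^sup>2 / (2 * pi) ^ CARD('n))"
      unfolding dispersion_momentum_def norm_fourier by simp
    ultimately show ?thesis
      using uncertainty_schwartz[OF g unit] by simp
  qed
  have "real CARD('n) / 2 = (\<Sum>j\<in>(UNIV :: 'n set). 1 / 2)"
    by simp
  \<comment> \<open>Square roots are taken so that the squares in Cauchy-Schwarz add up to the
    dispersions themselves.\<close>
  also have "\<dots> \<le> (\<Sum>j\<in>UNIV. sqrt (?a j) * sqrt (?b j))"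
  proof (rule sum_mono)
    fix j
    \<comment> \<open>The lower bound 1/2 is relaxed to 1/4, whose root 1/2 sums to n/2 and gives
      the stated n^2/4; keeping 1/2 would give n^2/2.\<close>
    have "(1 / 2)\<^sup>2 \<le> ?a j * ?b j"
      using ab[of j] by (simp add: power2_eq_square)
    then show "1 / 2 \<le> sqrt (?a j) * sqrt (?b j)"
      unfolding real_sqrt_mult[symmetric] by (rule real_le_rsqrt)
  qed
  finally have "(real CARD('n) / 2)\<^sup>2 \<le> (\<Sum>j\<in>UNIV. sqrt (?a j) * sqrt (?b j))\<^sup>2"
    by (rule power_mono) simp
  also have "\<dots> \<le> (\<Sum>j\<in>UNIV. (sqrt (?a j))\<^sup>2) * (\<Sum>j\<in>UNIV. (sqrt (?b j))\<^sup>2)"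
    by (rule Cauchy_Schwarz_ineq_sum)
  finally show ?thesis
    using nonneg by (simp add: power_divide)
qed

end
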